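(* Define $$P_N(t)=\prod_{p\le N}(1-p^{-1/2-it})^{-1}$$ for $N\ge 1$ and $t\in\mathbf{R}$, the product being over primes $p\le N$. Let $z_0\in\mathbf{C}^{\times}$ be arbitrary and let $\varepsilon>0$ be such that $\varepsilon\le |z_0|$. There exists $N_0(z_0,\varepsilon)$, explicitly bounded, such that $$\liminf_{T\to+\infty}\frac1T\,\lambda\bigl(\{t\in[0,T]\,\mid\, |P_N(t)-z_0|<\varepsilon\}\bigr)\ \gg\ \Bigl(\frac{\varepsilon}{|z_0|}\Bigr)^2\frac{1}{\log\log N}$$ for all $N\ge N_0$, where the implied constant is absolute.
   Context: $\lambda$ denotes the Lebesgue measure on $\mathbf{R}$. The notation $f\gg g$ means that there is a constant $c>0$ (here absolute, i.e. independent of $z_0$, $\varepsilon$ and $N$) such that $f\ge c\,g$ for all values of the parameters under consideration. *)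

theory Defs
  imports
    "HOL-Analysis.Analysis"
    "HOL-Computational_Algebra.Primes"
begin

definition euler_P :: "nat \<Rightarrow> real \<Rightarrow> complex" where
  "euler_P N t = (\<Prod>p | prime p \<and> p \<le> N. inverse (1 - of_nat p powr (- (1 / 2) - \<i> * of_real t)))"

end

theory Submission
  imports Defs "HOL-Probability.Probability" "HOL-Complex_Analysis.Complex_Analysis"
    "HOL-Computational_Algebra.Squarefree"
begin

text \<open>
  Write \<open>P\<^sub>N = exp Y\<close> with \<open>Y(t) = \<Sum>\<^sub>p -Ln (1 - p\<^bsup>-1/2 - it\<^esup>)\<close> and \<open>w = Ln z\<^sub>0\<close>; it suffices that \<open>Y(t)\<close> lies in the
  disc of radius \<open>r = \<epsilon> / (2 |z\<^sub>0|)\<close> around \<open>w\<close>. The indicator of this disc is minorised by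
  \<open>e\<^bsup>-a|x|\<^sup>2\<^esup> - e\<^bsup>-2\<^esup> e\<^bsup>-a|x|\<^sup>2/2\<^esup>\<close> with \<open>a = 4 / r\<^sup>2\<close>, and each Gaussian is an average of characters
  \<open>cis (\<xi> \<bullet> x)\<close> over a Gaussian vector \<open>\<xi>\<close>. By independence of the \<open>ln p\<close> over the rationals, the time average of
  \<open>cis (\<xi> \<bullet> Y(t))\<close> tends to a product over \<open>p \<le> N\<close> of integrals over the circle, which a Taylor expansion
  compares with \<open>exp (-V |\<xi>|\<^sup>2 / 4)\<close>, where \<open>V = \<Sum>\<^sub>p 1/p\<close> is of order \<open>log log N\<close>. For a Gaussian
  of variance \<open>V\<close> the two test functions contribute about \<open>1/(aV)\<close> and \<open>2 e\<^bsup>-2\<^esup>/(aV)\<close>, whose difference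
  is a positive multiple of \<open>(\<epsilon>/|z\<^sub>0|)\<^sup>2 / V\<close>.
\<close>

text \<open>The frequencies \<xi> fill the whole plane, so the comparison with the normal law must
  hold up for large \<xi>, with a total error that is a small multiple of the main term
  \<open>1 / (a V)\<close>. Three ranges occur. For |\<xi>| \<le> 1 the Euler factors are compared
  one by one, in a way that keeps Gaussian decay in the error. For 1 < |\<xi>| \<le> V^3 both sides
  are tiny, because the primes beyond a cut-off of order V^6 still carry half of \<open>V\<close>.
  Beyond V^3 only the bound 1 is left, and the Gaussian weight of \<xi> supplies the smallness. The
  choice a r^2 = 4 makes the two Gaussians of the minorant cross at |x| = r. Halving the rate
  doubles the mass, so positivity of the limit comes from 2 e^(-2) < 1. As \<open>V\<close> grows
  like log log N, a lower bound on \<open>V\<close> becomes a doubly exponential bound on N. The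
  term (ln |\<open>z\<^sub>0\<close>|)^2 keeps \<open>w\<close> in the bulk of the normal law, and
  |\<open>z\<^sub>0\<close>| / \<epsilon> keeps the third range negligible. The upper bound for
  \<open>V\<close> turns 1/V into 1 / log log N.\<close>

subsection \<open>Reciprocals of primes\<close>

definition primes_upto :: "nat \<Rightarrow> nat set" where
  "primes_upto N = {p. prime p \<and> p \<le> N}"

lemma finite_primes_upto [simp]: "finite (primes_upto N)"
  by (rule finite_subset[of _ "{..N}"]) (auto simp: primes_upto_def)

lemma primes_upto_prime: "p \<in> primes_upto N \<Longrightarrow> prime p"
  by (simp add: primes_upto_def)

lemma prod_one_plus:
  fixes x :: "'a \<Rightarrow> 'b::comm_semiring_1"
  assumes "finite A"
  shows "(\<Prod>a\<in>A. 1 + x a) = (\<Sum>S\<in>Pow A. \<Prod>a\<in>S. x a)"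
  using prod_add[OF assms, of x "\<lambda>_. 1"] by (simp add: add.commute)

text \<open>Unique factorisation: \<open>prime_factors\<close> recovers the set, so subset products
  can be counted as distinct integers.\<close>

lemma inj_on_Prod_primes:
  "inj_on (\<lambda>S::nat set. \<Prod>S) {S. finite S \<and> (\<forall>p\<in>S. prime p)}"
proof (rule inj_on_inverseI[where g = prime_factors])
  fix S :: "nat set"
  assume S: "S \<in> {S. finite S \<and> (\<forall>p\<in>S. prime p)}"
  have nz: "\<Prod>S \<noteq> 0" using S by (auto simp: prod_zero_iff)
  show "prime_factors (\<Prod>S) = S"
  proof (intro set_eqI iffI)
    fix p assume "p \<in> prime_factors (\<Prod>S)"
    then have "prime p" "p dvd \<Prod>S" by (auto dest: in_prime_factors_imp_prime in_prime_factors_imp_dvd)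
    then obtain q where "q \<in> S" "p dvd q" using S by (auto simp: prime_dvd_prod_iff)
    then show "p \<in> S" using \<open>prime p\<close> S primes_dvd_imp_eq by blast
  next
    fix p assume "p \<in> S"
    then show "p \<in> prime_factors (\<Prod>S)"
      using S nz by (auto intro!: prime_factorsI dvd_prodI simp: prime_gt_0_nat)
  qed
qed

text \<open>Mean value theorem for x^(-s) on [n, n+1], arranged so that the right side telescopes
  when summed over n.\<close>

lemma powr_telescope:
  fixes s :: real
  assumes "s > 0" "n \<ge> 1"
  shows "real (Suc n) powr (- 1 - s) \<le> (real n powr (-s) - real (Suc n) powr (-s)) / s"
proof -
  have "\<exists>z>real n. z < real (Suc n) \<and> real (Suc n) powr (-s) - real n powr (-s) = (real (Suc n) - real n) * (-s * z powr (-s - 1))"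
    by (rule MVT2) (use assms in \<open>auto intro!: derivative_eq_intros\<close>)
  then obtain z where z: "z > real n" "z < real (Suc n)"
    "real (Suc n) powr (-s) - real n powr (-s) = -s * z powr (-s - 1)" by auto
  have "real (Suc n) powr (-1 - s) \<le> z powr (-1-s)"
    using z assms by (intro powr_mono2') auto
  also have "z powr (-1 - s) = z powr (-s - 1)" by (rule arg_cong[where f = "(powr) z"]) simp
  also have "z powr (-s - 1) = (real n powr (-s) - real (Suc n) powr (-s)) / s"
    using z(3) assms by (simp add: field_simps)
  finally show ?thesis .
qed

lemma sum_powr_le:
  fixes s :: real
  assumes "s > 0"
  shows "(\<Sum>n=1..m. real n powr (-1-s)) \<le> 1 + 1/s"
proof (cases "m = 0")
  case False
  have "(\<Sum>n=1..m. real n powr (-1-s)) \<le> 1 + (1 - real m powr (-s)) / s" if "m \<ge> 1" for m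
    using that
  proof (induction m rule: nat_induct_at_least)
    case base
    then show ?case by simp
  next
    case (Suc n)
    have "(\<Sum>n=1..Suc n. real n powr (-1-s)) \<le> 1 + (1 - real n powr (-s)) / s + real (Suc n) powr (-1-s)"
      using Suc by simp
    also have "\<dots> \<le> 1 + (1 - real n powr (-s)) / s + (real n powr (-s) - real (Suc n) powr (-s)) / s"
      using powr_telescope[of s n] assms Suc by simp
    finally show ?case by (simp add: diff_divide_distrib)
  qed
  from this[of m] False have "(\<Sum>n=1..m. real n powr (-1-s)) \<le> 1 + (1 - real m powr (-s)) / s" by simp
  also have "\<dots> \<le> 1 + 1 / s" using assms by (simp add: divide_right_mono)
  finally show ?thesis .
qed (use assms in auto)

lemma sum_le_sum_superset_image:
  fixes f :: "'b \<Rightarrow> real"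
  assumes "inj_on h A" "h ` A \<subseteq> B" "finite B" "\<And>b. b \<in> B \<Longrightarrow> f b \<ge> 0"
  shows "(\<Sum>a\<in>A. f (h a)) \<le> sum f B"
proof -
  have "(\<Sum>a\<in>A. f (h a)) = sum f (h ` A)" using assms(1) by (simp add: sum.reindex)
  also have "\<dots> \<le> sum f B" using assms by (intro sum_mono2) auto
  finally show ?thesis .
qed

text \<open>Every \<open>n\<close> is a square times a squarefree number, and the squarefree numbers up to \<open>N\<close> are
  products of distinct primes.\<close>

lemma harmonic_le_prod_primes:
  "(\<Sum>n=1..N. 1 / real n) \<le> (\<Sum>m=1..N. 1 / (real m)\<^sup>2) * (\<Prod>p\<in>primes_upto N. 1 + 1 / real p)"
proof -
  let ?h = "\<lambda>n. (square_part n, prime_factors (squarefree_part n))"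
  let ?B = "{1..N} \<times> Pow (primes_upto N)"
  let ?f = "\<lambda>(m, S). 1 / (real m)\<^sup>2 * (\<Prod>p\<in>S. 1 / real p)"
  have sqf: "squarefree_part n = \<Prod>(prime_factors (squarefree_part n))" if "n > 0" for n :: nat
  proof -
    have sq: "squarefree (squarefree_part n)" by simp
    then have nz: "squarefree_part n \<noteq> 0" by (metis not_squarefree_0)
    have "squarefree_part n = (\<Prod>p\<in>prime_factors (squarefree_part n). p ^ multiplicity p (squarefree_part n))"
      by (rule prime_factorization_nat) (use nz in \<open>simp add: neq0_conv[symmetric] del: neq0_conv\<close>)
    also have "\<dots> = \<Prod>(prime_factors (squarefree_part n))"
    proof (rule prod.cong[OF refl])
      fix p assume "p \<in> prime_factors (squarefree_part n)"
      then have "multiplicity p (squarefree_part n) = 1"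
        using sq squarefree_factorial_semiring'[OF nz] by blast
      then show "p ^ multiplicity p (squarefree_part n) = p" by simp
    qed
    finally show ?thesis .
  qed
  have eq: "1 / real n = ?f (?h n)" if "n \<in> {1..N}" for n
  proof -
    have "real n = real (squarefree_part n) * (real (square_part n))\<^sup>2"
      using arg_cong[OF squarefree_decompose[of n], of real] by (simp only: of_nat_mult of_nat_power)
    moreover have "real (squarefree_part n) = (\<Prod>p\<in>prime_factors (squarefree_part n). real p)"
      using arg_cong[OF sqf[of n], of real] that by (simp add: of_nat_prod)
    ultimately have "1 / real n = 1 / ((\<Prod>p\<in>prime_factors (squarefree_part n). real p) * (real (square_part n))\<^sup>2)"
      by simp
    then show ?thesis by (simp add: prod_dividef)
  qed
  have inj: "inj_on ?h {1..N}"
  proof (rule inj_onI)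
    fix m n assume mn: "m \<in> {1..N}" "n \<in> {1..N}" "?h m = ?h n"
    have "squarefree_part m = \<Prod>(prime_factors (squarefree_part m))" by (rule sqf) (use mn in auto)
    also have "\<dots> = \<Prod>(prime_factors (squarefree_part n))" using mn(3) by simp
    also have "\<dots> = squarefree_part n" by (rule sqf[symmetric]) (use mn in auto)
    finally have "squarefree_part m = squarefree_part n" .
    moreover have "square_part m = square_part n" using mn(3) by simp
    ultimately show "m = n" by (rule squarefree_decomposition_unique[rotated])
  qed
  have img: "?h ` {1..N} \<subseteq> ?B"
  proof
    fix x assume "x \<in> ?h ` {1..N}"
    then obtain n where n: "n \<in> {1..N}" "x = ?h n" by auto
    have d1: "square_part n dvd n" by (metis dvd_mult_left dvd_triv_right power2_eq_square square_part_square_dvd)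
    have d2: "squarefree_part n dvd n" by (metis dvd_triv_left squarefree_decompose)
    have "square_part n > 0" using n square_part_0_iff[of n] by (intro gr0I) auto
    moreover have "square_part n \<le> n" using d1 n by (auto intro: dvd_imp_le)
    moreover have "p \<in> primes_upto N" if "p \<in> prime_factors (squarefree_part n)" for p
    proof -
      have "prime p" "p dvd n" using that d2 by (auto intro: dvd_trans in_prime_factors_imp_dvd)
      then have "p \<le> n" using n by (intro dvd_imp_le) auto
      then show ?thesis using \<open>prime p\<close> n by (auto simp: primes_upto_def)
    qed
    ultimately show "x \<in> ?B" using n by (auto simp: Suc_le_eq)
  qed
  have "(\<Sum>n=1..N. 1 / real n) = (\<Sum>n=1..N. ?f (?h n))" by (rule sum.cong[OF refl eq])
  also have "\<dots> \<le> sum ?f ?B"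
    by (rule sum_le_sum_superset_image[OF inj img]) (auto intro!: divide_nonneg_nonneg prod_nonneg)
  also have "\<dots> = (\<Sum>m=1..N. 1 / (real m)\<^sup>2) * (\<Sum>S\<in>Pow (primes_upto N). \<Prod>p\<in>S. 1 / real p)"
    by (simp only: sum_product sum.cartesian_product)
  finally show ?thesis by (simp add: prod_one_plus)
qed

definition prime_recip :: "nat \<Rightarrow> real" where
  "prime_recip N = (\<Sum>p\<in>primes_upto N. 1 / real p)"

text \<open>Euler's argument. The squares contribute at most 2, whence the loss of
  \<open>ln 2\<close>, and 1 + x \<le> e^x turns the product over primes into the exponential of
  \<open>prime_recip N\<close>.\<close>

lemma prime_recip_ge:
  assumes "N \<ge> 3"
  shows "prime_recip N \<ge> ln (ln (real N)) - ln 2"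
proof -
  have "(\<Sum>m=1..N. 1 / (real m)\<^sup>2) = (\<Sum>m=1..N. real m powr (-1-1))"
    by (intro sum.cong) (auto simp: powr_minus powr_numeral divide_simps)
  also have "\<dots> \<le> 2" using sum_powr_le[of 1 N] by simp
  finally have sq: "(\<Sum>m=1..N. 1 / (real m)\<^sup>2) \<le> 2" .
  have "ln (real N) \<le> ln (real N + 1)" using assms by simp
  also have "\<dots> \<le> harm N" by (rule harm_ge_ln)
  also have "\<dots> = (\<Sum>n=1..N. 1 / real n)" by (simp add: harm_def field_simps)
  also have "\<dots> \<le> (\<Sum>m=1..N. 1 / (real m)\<^sup>2) * (\<Prod>p\<in>primes_upto N. 1 + 1 / real p)"
    by (rule harmonic_le_prod_primes)
  also have "\<dots> \<le> 2 * (\<Prod>p\<in>primes_upto N. 1 + 1 / real p)"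
    by (intro mult_right_mono sq prod_nonneg) auto
  also have "\<dots> \<le> 2 * (\<Prod>p\<in>primes_upto N. exp (1 / real p))"
    by (intro mult_left_mono prod_mono) auto
  also have "\<dots> = 2 * exp (prime_recip N)" by (simp add: exp_sum prime_recip_def)
  finally have le: "ln (real N) \<le> 2 * exp (prime_recip N)" .
  have "ln (ln (real N)) \<le> ln (2 * exp (prime_recip N))"
    using le assms by (intro ln_mono) auto
  then show ?thesis by (simp add: ln_mult)
qed

section \<open>Upper bounds for sums over primes\<close>

lemma half_le_ln_one_plus: "x / 2 \<le> ln (1 + x)" if "0 \<le> x" "x \<le> 1" for x :: real
proof -
  have "x / 2 \<le> x / (1 + x)" using that by (intro divide_left_mono) auto
  also have "\<dots> = 1 - inverse (1 + x)" using that by (simp add: field_simps)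
  also have "\<dots> \<le> ln (1 + x)"
    using ln_le_minus_one[of "inverse (1 + x)"] that by (simp add: ln_inverse)
  finally show ?thesis .
qed

text \<open>Rankin's trick: with s = 1 / ln N every p \<le> N satisfies p^(-s) \<ge> 1/e, so 1/p can
  be replaced by e p^(-1-s). The product of the 1 + p^(-1-s) is part of a convergent sum over
  integers, bounded by 1 + 1/s = 1 + ln N. The factor 2 is the loss in
  \<open>half_le_ln_one_plus\<close>.\<close>

lemma prime_recip_le:
  assumes "N \<ge> 3"
  shows "prime_recip N \<le> 2 * exp 1 * ln (1 + ln (real N))"
proof -
  define s where "s = 1 / ln (real N)"
  have lnN: "ln (real N) > 0" using assms by simp
  have s: "s > 0" using lnN by (simp add: s_def)
  let ?x = "\<lambda>p. real p powr (-1-s)"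
  \<comment> \<open>The range only has to contain every subset product, and the largest of these is
    the product of all primes up to N.\<close>
  let ?B = "{1..\<Prod>(primes_upto N)}"
  have "(\<Prod>p\<in>primes_upto N. 1 + ?x p) = (\<Sum>S\<in>Pow (primes_upto N). \<Prod>p\<in>S. ?x p)"
    by (simp add: prod_one_plus)
  also have "\<dots> = (\<Sum>S\<in>Pow (primes_upto N). ?x (\<Prod>S))"
    by (intro sum.cong) (auto simp: prod_powr_distrib)
  also have "\<dots> \<le> sum ?x ?B"
  proof (rule sum_le_sum_superset_image)
    show "inj_on Prod (Pow (primes_upto N))"
      by (rule inj_on_subset[OF inj_on_Prod_primes])
         (auto intro: finite_subset[OF _ finite_primes_upto] dest: primes_upto_prime)
    show "Prod ` Pow (primes_upto N) \<subseteq> ?B"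
    proof clarsimp
      fix S assume S: "S \<subseteq> primes_upto N"
      have pos: "\<Prod>T > 0" if "T \<subseteq> primes_upto N" for T :: "nat set"
        using that by (intro prod_pos) (auto dest!: primes_upto_prime subsetD simp: prime_gt_0_nat)
      have "\<Prod>S dvd \<Prod>(primes_upto N)" using S by (intro prod_dvd_prod_subset) auto
      then show "Suc 0 \<le> \<Prod>S \<and> \<Prod>S \<le> \<Prod>(primes_upto N)"
        using pos[OF S] pos[of "primes_upto N"] by (auto intro: dvd_imp_le simp: Suc_le_eq)
    qed
  qed auto
  also have "\<dots> \<le> 1 + 1 / s" using s by (rule sum_powr_le)
  finally have le: "(\<Prod>p\<in>primes_upto N. 1 + ?x p) \<le> 1 + ln (real N)" by (simp add: s_def)
  have "prime_recip N \<le> (\<Sum>p\<in>primes_upto N. exp 1 * ?x p)"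
    unfolding prime_recip_def
  proof (rule sum_mono)
    fix p assume p: "p \<in> primes_upto N"
    then have p2: "p \<ge> 2" "p \<le> N" by (auto simp: primes_upto_def prime_ge_2_nat)
    have "exp (-1) \<le> real p powr (-s)"
    proof -
      have "ln (real p) \<le> ln (real N)" using p2 by simp
      then have "s * ln (real p) \<le> 1" using lnN by (simp add: s_def)
      then show ?thesis using p2 by (simp add: powr_def)
    qed
    then have "1 \<le> exp 1 * real p powr (-s)" by (simp add: exp_minus field_simps)
    then have "1 / real p * 1 \<le> 1 / real p * (exp 1 * real p powr (-s))"
      by (intro mult_left_mono) auto
    also have "\<dots> = exp 1 * ?x p" using p2 by (simp add: powr_diff powr_minus field_simps)
    finally show "1 / real p \<le> exp 1 * ?x p" by simp
  qed
  also have "\<dots> = 2 * exp 1 * (\<Sum>p\<in>primes_upto N. ?x p / 2)"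
    by (simp add: sum_distrib_left sum_divide_distrib)
  also have "\<dots> \<le> 2 * exp 1 * (\<Sum>p\<in>primes_upto N. ln (1 + ?x p))"
  proof (intro mult_left_mono sum_mono half_le_ln_one_plus)
    fix p assume "p \<in> primes_upto N"
    then have "p \<ge> 1" using prime_ge_1_nat primes_upto_prime by blast
    then have "real p powr (-1-s) \<le> real p powr 0" using s by (intro powr_mono) auto
    then show "?x p \<le> 1" using \<open>p \<ge> 1\<close> by simp
  qed auto
  also have "(\<Sum>p\<in>primes_upto N. ln (1 + ?x p)) = ln (\<Prod>p\<in>primes_upto N. 1 + ?x p)"
    by (subst ln_prod) (auto simp: add_pos_nonneg order_less_imp_not_eq2)
  also have "2 * exp 1 * ln (\<Prod>p\<in>primes_upto N. 1 + ?x p) \<le> 2 * exp 1 * ln (1 + ln (real N))"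
    using le by (intro mult_left_mono ln_mono prod_pos) (auto simp: add_pos_nonneg)
  finally show ?thesis .
qed

text \<open>The Taylor error at p is of order u^3 with u = 1 / sqrt p. Its total over all primes is
  bounded independently of N, while the main terms u^2 add up to the unbounded
  \<open>prime_recip N\<close>.\<close>

lemma sum_primes_three_halves:
  "(\<Sum>p\<in>primes_upto N. 1 / (sqrt (real p)) ^ 3) \<le> 3"
proof -
  have "(\<Sum>p\<in>primes_upto N. 1 / (sqrt (real p)) ^ 3) = (\<Sum>p\<in>primes_upto N. real p powr (-1-1/2))"
  proof (intro sum.cong refl)
    fix p assume "p \<in> primes_upto N"
    then have "p > 0" using primes_upto_prime prime_gt_0_nat by blast
    then have "(sqrt (real p)) ^ 3 = real p powr (3/2)"
      by (simp add: powr_half_sqrt[symmetric] powr_power)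
    then show "1 / (sqrt (real p)) ^ 3 = real p powr (-1-1/2)"
      by (simp add: powr_minus_divide)
  qed
  also have "\<dots> \<le> (\<Sum>n=1..N. real n powr (-1-1/2))"
    by (intro sum_mono2) (auto simp: primes_upto_def prime_ge_1_nat Suc_le_eq prime_gt_0_nat)
  also have "\<dots> \<le> 3" using sum_powr_le[of "1/2" N] by simp
  finally show ?thesis .
qed

text \<open>Cruder than \<open>prime_recip_le\<close>, but sufficient for cut-offs that are
  polynomial in \<open>V\<close>, whose logarithm is far below \<open>V / 2\<close>.\<close>

lemma prime_recip_le_ln: 
  assumes "N \<ge> 1"
  shows "prime_recip N \<le> 1 + ln (real N)"
proof -
  have "prime_recip N \<le> (\<Sum>n=1..N. 1 / real n)"
    unfolding prime_recip_def
    by (intro sum_mono2) (auto simp: primes_upto_def prime_ge_1_nat Suc_le_eq prime_gt_0_nat)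
  also have "\<dots> = harm N" by (simp add: harm_def field_simps)
  also have "\<dots> \<le> 1 + ln (real N)"
    \<comment> \<open>The library's decreasing sequence is harm (n+1) - ln (n+1), hence the indices
      0 and N - 1; its first value is 1.\<close>
    using decseqD[OF decseq_harm_diff_ln, of 0 "N - 1"] assms by (simp add: harm_def)
  finally show ?thesis .
qed

subsection \<open>Time averages and independence of the prime frequencies\<close>

definition has_mean :: "(real \<Rightarrow> complex) \<Rightarrow> complex \<Rightarrow> bool" where
  "has_mean f m \<longleftrightarrow> ((\<lambda>T. integral {0..T} f / of_real T) \<longlongrightarrow> m) at_top"

lemma has_mean_cis: "has_mean (\<lambda>t. cis (l * t)) (if l = 0 then 1 else 0)"
proof (cases "l = 0")
  case True
  have "eventually (\<lambda>T. integral {0..T} (\<lambda>t. cis (l * t)) / of_real T = 1) at_top"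
    using eventually_gt_at_top[of "0::real"]
    by eventually_elim (use True in \<open>simp add: scaleR_conv_of_real\<close>)
  then show ?thesis using True by (simp add: has_mean_def tendsto_eventually)
next
  case False
  have "((\<lambda>T. integral {0..T} (\<lambda>t. cis (l * t)) / of_real T) \<longlongrightarrow> 0) at_top"
  proof (rule Lim_null_comparison)
    show "eventually (\<lambda>T. norm (integral {0..T} (\<lambda>t. cis (l * t)) / of_real T) \<le> 2 / \<bar>l\<bar> / T) at_top"
      using eventually_gt_at_top[of "0::real"]
    proof eventually_elim
      case (elim T)
      have "((\<lambda>t. cis (l * t)) has_integral (cis (l * T) / (\<i> * l) - cis (l * 0) / (\<i> * l))) {0..T}"
      proof (rule fundamental_theorem_of_calculus)
        fix x assume "x \<in> {0..T}"
        have "((\<lambda>t. exp (\<i> * of_real (l * t)) / (\<i> * l)) has_vector_derivative cis (l * x)) (at x within {0..T})"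
          by (rule has_vector_derivative_eq_rhs, (rule derivative_eq_intros has_vector_derivative_real_field refl | simp)+)
             (use False in \<open>auto simp: cis_conv_exp field_simps\<close>)
        then show "((\<lambda>t. cis (l * t) / (\<i> * l)) has_vector_derivative cis (l * x)) (at x within {0..T})"
          by (simp add: cis_conv_exp)
      qed (use elim in simp)
      then have "integral {0..T} (\<lambda>t. cis (l * t)) = (cis (l * T) - 1) / (\<i> * l)"
        by (simp add: integral_unique diff_divide_distrib)
      moreover have "norm (cis (l * T) - 1) \<le> 2"
        using norm_triangle_ineq4[of "cis (l * T)" 1] by simp
      ultimately show ?case using elim by (simp add: norm_divide norm_mult divide_right_mono)
    qed
    show "((\<lambda>T. 2 / \<bar>l\<bar> / T) \<longlongrightarrow> 0) at_top"
      by (intro tendsto_divide_0[OF tendsto_const] filterlim_at_top_imp_at_infinity filterlim_ident)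
  qed
  then show ?thesis using False by (simp add: has_mean_def)
qed

lemma has_mean_sum:
  assumes "\<And>i. i \<in> I \<Longrightarrow> has_mean (f i) (m i)" "\<And>i. i \<in> I \<Longrightarrow> continuous_on UNIV (f i)"
  shows "has_mean (\<lambda>t. \<Sum>i\<in>I. f i t) (\<Sum>i\<in>I. m i)"
proof (cases "finite I")
  case True
  have "integral {0..T} (\<lambda>t. \<Sum>i\<in>I. f i t) / of_real T = (\<Sum>i\<in>I. integral {0..T} (f i) / of_real T)" for T
    by (subst integral_sum[OF True])
       (auto simp: sum_divide_distrib intro!: integrable_continuous_real continuous_on_subset[OF assms(2)])
  then show ?thesis
    using assms(1) unfolding has_mean_def by (simp add: tendsto_sum)
qed (simp add: has_mean_def)

lemma has_mean_cmult: "has_mean f m \<Longrightarrow> has_mean (\<lambda>t. c * f t) (c * m)"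
  unfolding has_mean_def by (simp add: tendsto_mult_left flip: times_divide_eq_right)

text \<open>Averaging is a contraction for the supremum norm. The candidate mean \<open>m\<close> is
  given beforehand, so it only has to be close to the means of the approximants.\<close>

lemma has_mean_uniform_limit:
  assumes f: "continuous_on UNIV f"
    and approx: "\<And>e. e > 0 \<Longrightarrow> \<exists>g m'. continuous_on UNIV g \<and> has_mean g m' \<and> (\<forall>t. norm (f t - g t) \<le> e) \<and> norm (m - m') \<le> e"
  shows "has_mean f m"
  unfolding has_mean_def
proof (rule tendstoI)
  fix e :: real assume "e > 0"
  then obtain g m' where g: "continuous_on UNIV g" "has_mean g m'" "\<And>t. norm (f t - g t) \<le> e/4"
    "norm (m - m') \<le> e/4" using approx[of "e/4"] by auto
  have "eventually (\<lambda>T. dist (integral {0..T} g / of_real T) m' < e / 4) at_top"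
    using tendstoD[OF g(2)[unfolded has_mean_def], of "e/4"] \<open>e > 0\<close> by simp
  then show "eventually (\<lambda>T. dist (integral {0..T} f / of_real T) m < e) at_top"
    using eventually_gt_at_top[of "0::real"]
  proof eventually_elim
    case (elim T)
    have int: "f integrable_on {0..T}" "g integrable_on {0..T}"
      using f g(1) by (auto intro!: integrable_continuous_real intro: continuous_on_subset)
    have "norm (integral {0..T} (\<lambda>t. f t - g t)) \<le> e/4 * (T - 0)"
      using elim g(1,3) f
      by (intro integral_bound) (auto intro!: continuous_intros intro: continuous_on_subset)
    then have "norm (integral {0..T} f / of_real T - integral {0..T} g / of_real T) \<le> e/4"
      using elim int by (simp add: integral_diff norm_divide field_simps flip: diff_divide_distrib)
    moreover have "norm (integral {0..T} g / of_real T - m') < e/4" using elim by (simp add: dist_norm)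
    ultimately have "norm ((integral {0..T} f / of_real T - integral {0..T} g / of_real T) + (integral {0..T} g / of_real T - m') - (m - m')) < e"
      using g(4) \<open>e > 0\<close> norm_triangle_ineq4[of "(integral {0..T} f / of_real T - integral {0..T} g / of_real T) + (integral {0..T} g / of_real T - m')" "m - m'"]
        norm_triangle_ineq[of "integral {0..T} f / of_real T - integral {0..T} g / of_real T" "integral {0..T} g / of_real T - m'"]
      by linarith
    then show ?case by (simp add: dist_norm)
  qed
qed

text \<open>Moving the negative coefficients to the other side gives two natural numbers with equal
  logarithms; truncation by \<open>nat\<close> performs the split. Unique factorisation then gives
  \<open>nat (k p) = nat (- k p)\<close>, which forces both to vanish.\<close>

lemma ln_primes_independent:
  fixes k :: "nat \<Rightarrow> int"
  assumes P: "finite P" "\<And>p. p \<in> P \<Longrightarrow> prime p"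
    and zero: "(\<Sum>p\<in>P. of_int (k p) * ln (real p)) = 0"
    and p: "p \<in> P"
  shows "k p = 0"
proof -
  define A where "A = (\<Prod>p\<in>P. p ^ nat (k p))"
  define B where "B = (\<Prod>p\<in>P. p ^ nat (- k p))"
  have pos: "p > 0" if "p \<in> P" for p using P(2)[OF that] by (rule prime_gt_0_nat)
  have lnA: "ln (real A) = (\<Sum>p\<in>P. real (nat (k p)) * ln (real p))"
    unfolding A_def of_nat_prod of_nat_power
    by (subst ln_prod) (use P(1) pos in \<open>auto simp: ln_realpow\<close>)
  have lnB: "ln (real B) = (\<Sum>p\<in>P. real (nat (- k p)) * ln (real p))"
    unfolding B_def of_nat_prod of_nat_power
    by (subst ln_prod) (use P(1) pos in \<open>auto simp: ln_realpow\<close>)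
  have "ln (real A) - ln (real B) = (\<Sum>p\<in>P. of_int (k p) * ln (real p))"
    unfolding lnA lnB sum_subtractf[symmetric]
  proof (rule sum.cong[OF refl])
    fix x show "real (nat (k x)) * ln (real x) - real (nat (- k x)) * ln (real x) = real_of_int (k x) * ln (real x)"
      by (cases "k x \<ge> 0") auto
  qed
  then have "ln (real A) = ln (real B)" using zero by simp
  moreover have "A > 0" "B > 0" using pos by (auto simp: A_def B_def intro!: prod_pos)
  ultimately have "A = B" by simp
  have "multiplicity p A = nat (k p)" "multiplicity p B = nat (- k p)"
    unfolding A_def B_def using P p by (auto intro!: multiplicity_prod_prime_powers[THEN trans])
  with \<open>A = B\<close> have "nat (k p) = nat (- k p)" by simp
  then show ?thesis by linarith
qed

text \<open>A list of (coefficient, frequency) pairs. Frequencies may repeat, so sums are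
  concatenations and products need no collecting of like terms.\<close>

definition trig_sum :: "(complex \<times> int) list \<Rightarrow> real \<Rightarrow> complex" where
  "trig_sum xs x = (\<Sum>j<length xs. fst (xs ! j) * cis (of_int (snd (xs ! j)) * x))"

lemma trig_sum_Nil [simp]: "trig_sum [] x = 0"
  by (simp add: trig_sum_def)

lemma trig_sum_Cons [simp]: "trig_sum ((c, m) # xs) x = c * cis (of_int m * x) + trig_sum xs x"
  by (simp add: trig_sum_def sum.lessThan_Suc_shift del: sum.lessThan_Suc)

lemma trig_sum_append: "trig_sum (xs @ ys) x = trig_sum xs x + trig_sum ys x"
  by (induction xs) auto

lemma trig_sum_monomial_mult:
  "trig_sum (map (\<lambda>(d, n). (c * d, m + n)) xs) x = c * cis (of_int m * x) * trig_sum xs x"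
  by (induction xs) (auto simp: algebra_simps cis_mult)

text \<open>With \<open>trig_sum_append\<close> this makes trigonometric sums an algebra, as the
  induction over polynomials requires.\<close>

lemma trig_sum_mult: "\<exists>zs. \<forall>x. trig_sum zs x = trig_sum xs x * trig_sum ys x"
proof (induction xs)
  case Nil
  show ?case by (rule exI[of _ "[]"]) simp
next
  case (Cons a xs)
  obtain c m where a: "a = (c, m)" by (cases a)
  from Cons obtain zs where "\<forall>x. trig_sum zs x = trig_sum xs x * trig_sum ys x" by blast
  then show ?case
    by (intro exI[of _ "map (\<lambda>(d, n). (c * d, m + n)) ys @ zs"])
       (simp add: trig_sum_append trig_sum_monomial_mult a distrib_right)
qed

lemma continuous_trig_sum: "continuous_on S (trig_sum xs)"
  unfolding trig_sum_def[abs_def] by (intro continuous_intros)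

text \<open>The constant Fourier coefficient; it is a sum because several entries may carry
  frequency 0.\<close>

definition trig_mean :: "(complex \<times> int) list \<Rightarrow> complex" where
  "trig_mean xs = (\<Sum>j<length xs. if snd (xs ! j) = 0 then fst (xs ! j) else 0)"

lemma integral_cis_01: "integral {0..1} (\<lambda>x. cis (of_int m * (2 * pi * x))) = (if m = 0 then 1 else 0)"
proof (cases "m = 0")
  case False
  let ?l = "complex_of_real (of_int m * 2 * pi)"
  have "((\<lambda>x. cis (of_int m * (2 * pi * x))) has_integral
     (cis (of_int m * (2 * pi * 1)) / (\<i> * ?l) - cis (of_int m * (2 * pi * 0)) / (\<i> * ?l))) {0..1}"
  proof (rule fundamental_theorem_of_calculus)
    fix x :: real assume "x \<in> {0..1}"
    have "((\<lambda>x. exp (\<i> * of_real (of_int m * (2 * pi * x))) / (\<i> * ?l)) has_vector_derivative cis (of_int m * (2 * pi * x))) (at x within {0..1})"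
      by (rule has_vector_derivative_eq_rhs, (rule derivative_eq_intros has_vector_derivative_real_field refl | simp)+)
         (use False in \<open>auto simp: cis_conv_exp field_simps\<close>)
    then show "((\<lambda>x. cis (of_int m * (2 * pi * x)) / (\<i> * ?l)) has_vector_derivative cis (of_int m * (2 * pi * x))) (at x within {0..1})"
      by (simp add: cis_conv_exp)
  qed simp
  moreover have "cis (of_int m * (2 * pi * 1)) = 1"
    using cis_multiple_2pi[of "of_int m"] by (simp add: mult_ac)
  ultimately show ?thesis using False by (simp add: integral_unique)
qed simp

lemma integral_trig_sum: "integral {0..1} (\<lambda>x. trig_sum xs (2 * pi * x)) = trig_mean xs"
  unfolding trig_sum_def trig_mean_def
  by (subst integral_sum)
     (auto simp: integral_cis_01 intro!: integrable_continuous_real continuous_intros sum.cong)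

text \<open>Expanding the product, each \<open>g\<close> selects one term per prime. By
  \<open>ln_primes_independent\<close> the combined frequency vanishes only if every selected
  frequency does, so precisely the products of constant terms survive averaging.\<close>

lemma has_mean_prod_trig_sum:
  assumes P: "finite P" "\<And>p. p \<in> P \<Longrightarrow> prime p"
  shows "has_mean (\<lambda>t. \<Prod>p\<in>P. trig_sum (xs p) (- t * ln (real p))) (\<Prod>p\<in>P. trig_mean (xs p))"
proof -
  let ?I = "PiE P (\<lambda>p. {..<length (xs p)})"
  let ?c = "\<lambda>g. \<Prod>p\<in>P. fst (xs p ! g p)"
  let ?l = "\<lambda>g. - (\<Sum>p\<in>P. of_int (snd (xs p ! g p)) * ln (real p))"
  have prod_cis: "(\<Prod>p\<in>P. cis (h p)) = cis (\<Sum>p\<in>P. h p)" for h :: "nat \<Rightarrow> real"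
    by (simp add: cis_conv_exp exp_sum[OF P(1)] sum_distrib_left)
  have eq: "(\<Prod>p\<in>P. trig_sum (xs p) (- t * ln (real p))) = (\<Sum>g\<in>?I. ?c g * cis (?l g * t))" for t
    unfolding trig_sum_def
    by (subst prod_sum_PiE)
       (use P in \<open>auto simp: prod.distrib prod_cis sum_distrib_left sum_negf sum_distrib_right mult_ac intro!: sum.cong\<close>)
  have zero: "?l g = 0 \<longleftrightarrow> (\<forall>p\<in>P. snd (xs p ! g p) = 0)" for g
    using ln_primes_independent[OF P, of "\<lambda>p. snd (xs p ! g p)"] by auto
  have eq2: "(\<Prod>p\<in>P. trig_mean (xs p)) = (\<Sum>g\<in>?I. ?c g * (if ?l g = 0 then 1 else 0))"
    unfolding trig_mean_def
  proof (subst prod_sum_PiE)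
    show "(\<Sum>g\<in>?I. \<Prod>p\<in>P. if snd (xs p ! g p) = 0 then fst (xs p ! g p) else 0) =
      (\<Sum>g\<in>?I. ?c g * (if ?l g = 0 then 1 else 0))"
    proof (rule sum.cong[OF refl])
      fix g
      show "(\<Prod>p\<in>P. if snd (xs p ! g p) = 0 then fst (xs p ! g p) else 0) = ?c g * (if ?l g = 0 then 1 else 0)"
        unfolding zero using P(1) by (auto intro!: prod.cong)
    qed
  qed (use P in auto)
  show ?thesis unfolding eq eq2
    by (intro has_mean_sum has_mean_cmult has_mean_cis continuous_intros)
qed

section \<open>Uniform approximation on the circle and equidistribution of the prime phases\<close>

lemma trig_sum_real_polynomial:
  assumes "real_polynomial_function (h :: complex \<Rightarrow> real)"
  shows "\<exists>xs. \<forall>x. of_real (h (cis x)) = trig_sum xs x"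
  using assms
proof induction
  case (linear f)
  then interpret bounded_linear f .
  have f: "f z = Re z * f 1 + Im z * f \<i>" for z
  proof -
    have "f z = f (Re z *\<^sub>R 1 + Im z *\<^sub>R \<i>)" by (rule arg_cong[of _ _ f]) (simp add: complex_eq_iff)
    then show ?thesis by (simp add: add scaleR)
  qed
  \<comment> \<open>The coefficients come from Re z = (z + 1/z) / 2 and Im z = (z - 1/z) / (2i) on
    the unit circle.\<close>
  have "of_real (f (cis x)) = trig_sum [((f 1 - \<i> * f \<i>) / 2, 1), ((f 1 + \<i> * f \<i>) / 2, -1)] x" for x
    by (subst f) (simp add: complex_eq_iff field_simps)
  then show ?case by blast
next
  case (const c)
  show ?case by (rule exI[of _ "[(of_real c, 0)]"]) simp
next
  case (add f g)
  then show ?case by (metis of_real_add trig_sum_append)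
next
  case (mult f g)
  then show ?case by (metis of_real_mult trig_sum_mult)
qed

text \<open>Besides being close, the approximants must have norm at most 1, since
  \<open>norm_prod_diff\<close> is applied to products of them. A Weierstrass approximation within
  e/2 has norm at most 1 + e/2; dividing by that number costs another e/2.\<close>

lemma trig_sum_approx:
  assumes f: "continuous_on (sphere 0 1) f" "\<And>z. norm z = 1 \<Longrightarrow> norm (f z) \<le> 1" and e: "e > 0"
  shows "\<exists>xs. (\<forall>x. norm (f (cis x) - trig_sum xs x) \<le> e) \<and> (\<forall>x. norm (trig_sum xs x) \<le> 1)"
proof -
  obtain g where g: "polynomial_function g" "\<And>z. z \<in> sphere 0 1 \<Longrightarrow> norm (f z - g z) < e/2"
    using Stone_Weierstrass_polynomial_function[OF compact_sphere f(1), of "e/2"] e by auto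
  have "real_polynomial_function (\<lambda>z. Re (g z))" "real_polynomial_function (\<lambda>z. Im (g z))"
    using g(1) bounded_linear_Re bounded_linear_Im unfolding polynomial_function_def o_def by blast+
  then obtain xs ys where xy: "\<And>x. of_real (Re (g (cis x))) = trig_sum xs x" "\<And>x. of_real (Im (g (cis x))) = trig_sum ys x"
    using trig_sum_real_polynomial by metis
  \<comment> \<open>Multiplication by a constant is the case m = 0 of
    \<open>trig_sum_monomial_mult\<close>, hence the form \<open>0 + n\<close>.\<close>
  define zs where "zs = map (\<lambda>(d, n). (1 / (1 + e/2) * d, 0 + n)) (xs @ map (\<lambda>(d, n). (\<i> * d, 0 + n)) ys)"
  have zs: "trig_sum zs x = g (cis x) / (1 + e/2)" for x
    unfolding zs_def trig_sum_monomial_mult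
    unfolding trig_sum_append trig_sum_monomial_mult xy[symmetric]
    by (simp add: complex_eq[symmetric] divide_simps)
  have b: "norm (g (cis x)) \<le> 1 + e/2" "norm (f (cis x) - g (cis x)) \<le> e/2" for x
    using f(2)[of "cis x"] g(2)[of "cis x"] norm_triangle_ineq3[of "f (cis x)" "g (cis x)"] by auto
  show ?thesis
  proof (intro exI[of _ zs] conjI allI)
    have ne: "norm (1 + complex_of_real e / 2) = 1 + e / 2"
    proof -
      have "1 + complex_of_real e / 2 = of_real (1 + e/2)" by simp
      then show ?thesis using e by (simp only: norm_of_real)
    qed
    show le1: "norm (trig_sum zs x) \<le> 1" for x using b(1)[of x] e by (simp add: zs norm_divide ne divide_le_eq)
    fix x
    have eq: "g (cis x) - trig_sum zs x = of_real (e/2) * trig_sum zs x"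
    proof -
      have "complex_of_real (e + 2) \<noteq> 0" using e by (simp only: of_real_eq_0_iff)
      then have "complex_of_real e + 2 \<noteq> 0" by simp
      then show ?thesis unfolding zs by (simp add: field_simps)
    qed
    have "norm (g (cis x) - trig_sum zs x) \<le> e/2"
      unfolding eq norm_mult norm_of_real using le1[of x] e by (simp add: mult_left_le)
    then show "norm (f (cis x) - trig_sum zs x) \<le> e"
      using b(2)[of x] norm_triangle_ineq[of "f (cis x) - g (cis x)" "g (cis x) - trig_sum zs x"] by simp
  qed
qed

text \<open>Kronecker-Weyl equidistribution of the phases p^(-it) on the torus, tested on product
  functions: approximate each factor by a trigonometric sum and control the product by the sum of
  the errors.\<close>

lemma has_mean_prod_primes:
  assumes P: "finite P" "\<And>p. p \<in> P \<Longrightarrow> prime p"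
    and cont: "\<And>p. p \<in> P \<Longrightarrow> continuous_on (sphere 0 1) (f p)"
    and bound: "\<And>p z. p \<in> P \<Longrightarrow> norm z = 1 \<Longrightarrow> norm (f p z) \<le> 1"
  shows "has_mean (\<lambda>t. \<Prod>p\<in>P. f p (cis (- t * ln (real p)))) (\<Prod>p\<in>P. integral {0..1} (\<lambda>x. f p (cis (2 * pi * x))))"
proof (rule has_mean_uniform_limit)
  have fcont: "continuous_on S (\<lambda>x. f p (cis (h x)))" if "p \<in> P" "continuous_on S h" for p S and h :: "real \<Rightarrow> real"
    by (rule continuous_on_compose2[OF cont[OF that(1)]]) (auto intro!: continuous_intros that(2))
  show "continuous_on UNIV (\<lambda>t. \<Prod>p\<in>P. f p (cis (- t * ln (real p))))"
    by (intro continuous_on_prod fcont continuous_intros)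
  fix e :: real assume e: "e > 0"
  \<comment> \<open>One share of the error per prime; the added 1 avoids division by zero for empty
    \<open>P\<close>.\<close>
  define d where "d = e / (real (card P) + 1)"
  have d: "d > 0" using e by (simp add: d_def)
  have "\<forall>p\<in>P. \<exists>xs. (\<forall>x. norm (f p (cis x) - trig_sum xs x) \<le> d) \<and> (\<forall>x. norm (trig_sum xs x) \<le> 1)"
    using trig_sum_approx cont bound d by blast
  then obtain xs where xs: "\<And>p x. p \<in> P \<Longrightarrow> norm (f p (cis x) - trig_sum (xs p) x) \<le> d"
    "\<And>p x. p \<in> P \<Longrightarrow> norm (trig_sum (xs p) x) \<le> 1"
    by metis
  have dP: "(\<Sum>p\<in>P. d) \<le> e"
  proof -
    have "real (card P) * d \<le> e" using e by (simp add: d_def field_simps)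
    then show ?thesis by simp
  qed
  have int: "norm (integral {0..1} (\<lambda>x. h (2 * pi * x))) \<le> B"
    if "continuous_on UNIV h" "\<And>x. norm (h x) \<le> B" for h :: "real \<Rightarrow> complex" and B
  proof -
    have "continuous_on {0..1} (\<lambda>x. h (2 * pi * x))"
      by (intro continuous_on_compose2[OF that(1)] continuous_intros) auto
    then show ?thesis using integral_bound[of 0 1 "\<lambda>x. h (2 * pi * x)" B] that(2) by simp
  qed
  show "\<exists>g m'. continuous_on UNIV g \<and> has_mean g m' \<and>
      (\<forall>t. norm ((\<Prod>p\<in>P. f p (cis (- t * ln (real p)))) - g t) \<le> e) \<and>
      norm ((\<Prod>p\<in>P. integral {0..1} (\<lambda>x. f p (cis (2 * pi * x)))) - m') \<le> e"
  proof (intro exI conjI allI)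
    show "has_mean (\<lambda>t. \<Prod>p\<in>P. trig_sum (xs p) (- t * ln (real p))) (\<Prod>p\<in>P. trig_mean (xs p))"
      by (rule has_mean_prod_trig_sum[OF P])
    show "continuous_on UNIV (\<lambda>t. \<Prod>p\<in>P. trig_sum (xs p) (- t * ln (real p)))"
      by (intro continuous_on_prod continuous_on_compose2[OF continuous_trig_sum[of UNIV]] continuous_intros) auto
    fix t
    have "norm ((\<Prod>p\<in>P. f p (cis (- t * ln (real p)))) - (\<Prod>p\<in>P. trig_sum (xs p) (- t * ln (real p))))
      \<le> (\<Sum>p\<in>P. norm (f p (cis (- t * ln (real p))) - trig_sum (xs p) (- t * ln (real p))))"
      by (intro norm_prod_diff) (auto intro: bound xs)
    also have "\<dots> \<le> (\<Sum>p\<in>P. d)" by (intro sum_mono xs)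
    finally show "norm ((\<Prod>p\<in>P. f p (cis (- t * ln (real p)))) - (\<Prod>p\<in>P. trig_sum (xs p) (- t * ln (real p)))) \<le> e"
      using dP by simp
  next
    have tm: "trig_mean (xs p) = integral {0..1} (\<lambda>x. trig_sum (xs p) (2 * pi * x))" for p
      by (simp add: integral_trig_sum)
    have intt: "norm (integral {0..1} (\<lambda>x. trig_sum (xs p) (2 * pi * x))) \<le> 1" if "p \<in> P" for p
      by (rule int[OF continuous_trig_sum xs(2)[OF that]])
    have intf: "norm (integral {0..1} (\<lambda>x. f p (cis (2 * pi * x)))) \<le> 1" if "p \<in> P" for p
      by (rule int[where h = "\<lambda>x. f p (cis x)"]) (auto intro!: bound that fcont continuous_intros)
    have "norm ((\<Prod>p\<in>P. integral {0..1} (\<lambda>x. f p (cis (2 * pi * x)))) - (\<Prod>p\<in>P. trig_mean (xs p)))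
      \<le> (\<Sum>p\<in>P. norm (integral {0..1} (\<lambda>x. f p (cis (2 * pi * x))) - trig_mean (xs p)))"
      by (intro norm_prod_diff)
         (auto simp: tm intro!: intf intt)
    also have "\<dots> \<le> (\<Sum>p\<in>P. d)"
    proof (rule sum_mono)
      fix p assume p: "p \<in> P"
      have "integral {0..1} (\<lambda>x. f p (cis (2 * pi * x))) - trig_mean (xs p) =
         integral {0..1} (\<lambda>x. f p (cis (2 * pi * x)) - trig_sum (xs p) (2 * pi * x))"
        unfolding tm
        by (intro integral_diff[symmetric] integrable_continuous_real fcont p
              continuous_on_compose2[OF continuous_trig_sum[of UNIV]] continuous_intros) auto
      also have "norm \<dots> \<le> d"
        by (rule int[where h = "\<lambda>x. f p (cis x) - trig_sum (xs p) x"])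
           (auto intro!: continuous_intros fcont p continuous_trig_sum xs)
      finally show "norm (integral {0..1} (\<lambda>x. f p (cis (2 * pi * x))) - trig_mean (xs p)) \<le> d" .
    qed
    finally show "norm ((\<Prod>p\<in>P. integral {0..1} (\<lambda>x. f p (cis (2 * pi * x)))) - (\<Prod>p\<in>P. trig_mean (xs p))) \<le> e"
      using dP by simp
  qed
qed

subsection \<open>The standard Gaussian measure on the complex plane\<close>

lemma integral_std_normal_exp_square_mult:
  fixes h :: "real \<Rightarrow> complex"
  assumes s: "s > -1/2" and h[measurable]: "h \<in> borel_measurable borel"
  shows "(\<integral>x. of_real (exp (- s * x\<^sup>2)) * h x \<partial>std_normal_distribution) =
    of_real (1 / sqrt (1 + 2 * s)) * (\<integral>x. h (x / sqrt (1 + 2 * s)) \<partial>std_normal_distribution)"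
proof -
  define \<sigma> where "\<sigma> = 1 / sqrt (1 + 2 * s)"
  have \<sigma>: "\<sigma> > 0" "\<sigma>\<^sup>2 = 1 / (1 + 2 * s)" using s by (auto simp: \<sigma>_def power_divide)
  have "(\<integral>x. of_real (exp (- s * x\<^sup>2)) * h x \<partial>std_normal_distribution) =
    (\<integral>x. std_normal_density x *\<^sub>R (of_real (exp (- s * x\<^sup>2)) * h x) \<partial>lborel)"
    by (subst integral_density) auto
  also have "\<dots> = \<bar>\<sigma>\<bar> *\<^sub>R (\<integral>x. std_normal_density (0 + \<sigma> * x) *\<^sub>R (of_real (exp (- s * (0 + \<sigma> * x)\<^sup>2)) * h (0 + \<sigma> * x)) \<partial>lborel)"
    by (rule lborel_integral_real_affine) (use \<sigma> in simp)
  also have "(\<lambda>x. std_normal_density (0 + \<sigma> * x) *\<^sub>R (of_real (exp (- s * (0 + \<sigma> * x)\<^sup>2)) * h (0 + \<sigma> * x)))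
     = (\<lambda>x. std_normal_density x *\<^sub>R h (\<sigma> * x))"
  proof
    fix x
    have "- (\<sigma> * x)\<^sup>2 / 2 - s * (\<sigma> * x)\<^sup>2 = - (\<sigma>\<^sup>2 * (1 + 2 * s)) * x\<^sup>2 / 2"
      by (simp add: power_mult_distrib algebra_simps)
    also have "\<sigma>\<^sup>2 * (1 + 2 * s) = 1" using s \<sigma> by simp
    finally have "exp (- (\<sigma> * x)\<^sup>2 / 2) * exp (- s * (\<sigma> * x)\<^sup>2) = exp (- x\<^sup>2 / 2)"
      by (simp add: exp_add[symmetric])
    then have "std_normal_density (\<sigma> * x) * exp (- s * (\<sigma> * x)\<^sup>2) = std_normal_density x"
      by (simp add: std_normal_density_def)
    then show "std_normal_density (0 + \<sigma> * x) *\<^sub>R (of_real (exp (- s * (0 + \<sigma> * x)\<^sup>2)) * h (0 + \<sigma> * x))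
     = std_normal_density x *\<^sub>R h (\<sigma> * x)"
      unfolding add_0 scaleR_conv_of_real mult.assoc[symmetric] of_real_mult[symmetric] by simp
  qed
  also have "(\<integral>x. std_normal_density x *\<^sub>R h (\<sigma> * x) \<partial>lborel) = (\<integral>x. h (\<sigma> * x) \<partial>std_normal_distribution)"
    by (subst integral_density) auto
  finally show ?thesis using \<sigma> by (simp add: \<sigma>_def scaleR_conv_of_real)
qed

lemma integrable_std_normal_exp_square:
  assumes s: "s > -1/2"
  shows "integrable std_normal_distribution (\<lambda>x. exp (- s * x\<^sup>2))"
proof -
  define \<sigma> where "\<sigma> = 1 / sqrt (1 + 2 * s)"
  have \<sigma>: "\<sigma> > 0" "\<sigma>\<^sup>2 = 1 / (1 + 2 * s)" using s by (auto simp: \<sigma>_def power_divide)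
  have eq: "std_normal_density x * exp (- s * x\<^sup>2) = \<sigma> * normal_density 0 \<sigma> x" for x
  proof -
    have "- x\<^sup>2 / 2 - s * x\<^sup>2 = - (x\<^sup>2 * (1 + 2 * s)) / 2" by (simp add: field_simps)
    also have "\<dots> = - x\<^sup>2 / (2 * \<sigma>\<^sup>2)" using \<sigma> by simp
    finally have "exp (- x\<^sup>2 / 2) * exp (- s * x\<^sup>2) = exp (- x\<^sup>2 / (2 * \<sigma>\<^sup>2))"
      by (simp add: exp_add[symmetric])
    then show ?thesis
      using \<sigma>(1) by (simp add: normal_density_def real_sqrt_mult)
  qed
  have "integrable lborel (\<lambda>x. std_normal_density x *\<^sub>R exp (- s * x\<^sup>2))"
    unfolding real_scaleR_def eq using \<sigma> by (intro integrable_mult_right) auto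
  then show ?thesis by (subst integrable_density) auto
qed

lemma integral_std_normal_cis: "(\<integral>x. cis (b * x) \<partial>std_normal_distribution) = of_real (exp (- b\<^sup>2 / 2))"
  using fun_cong[OF char_std_normal_distribution, of b] by (simp add: char_def cis_conv_exp)

lemma integral_std_normal_exp_square_cis:
  assumes "s > -1/2"
  shows "(\<integral>x. of_real (exp (- s * x\<^sup>2)) * cis (b * x) \<partial>std_normal_distribution) =
    of_real (exp (- b\<^sup>2 / (2 * (1 + 2 * s))) / sqrt (1 + 2 * s))"
proof -
  have "(\<lambda>x. cis (b * x)) \<in> borel_measurable borel"
    by (intro borel_measurable_continuous_onI continuous_intros)
  then have "(\<integral>x. of_real (exp (- s * x\<^sup>2)) * cis (b * x) \<partial>std_normal_distribution) =
     of_real (1 / sqrt (1 + 2 * s)) * (\<integral>x. cis (b / sqrt (1 + 2 * s) * x) \<partial>std_normal_distribution)"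
    using integral_std_normal_exp_square_mult[OF assms, of "\<lambda>x. cis (b * x)"] by simp
  then show ?thesis unfolding integral_std_normal_cis using assms
    by (simp add: power_divide mult.commute)
qed

section \<open>The planar Gaussian measure and its Fourier integrals\<close>

definition gauss :: "complex measure" where
  "gauss = distr (std_normal_distribution \<Otimes>\<^sub>M std_normal_distribution) borel (\<lambda>(x, y). Complex x y)"

lemma prob_space_std_normal: "prob_space std_normal_distribution"
  by (simp add: prob_space_normal_density)

lemma pair_prob_space_std_normal: "pair_prob_space std_normal_distribution std_normal_distribution"
  using prob_space_std_normal
  by (simp add: pair_prob_space_def pair_sigma_finite_def prob_space_imp_sigma_finite)

lemma measurable_Complex [measurable]:
  "(\<lambda>(x, y). Complex x y) \<in> borel_measurable (std_normal_distribution \<Otimes>\<^sub>M std_normal_distribution)"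
proof -
  have "(\<lambda>(x, y). Complex x y) \<in> borel_measurable (borel \<Otimes>\<^sub>M borel)"
    unfolding case_prod_beta Complex_eq by measurable
  then show ?thesis by simp
qed

lemma prob_space_gauss: "prob_space gauss"
proof -
  interpret pair_prob_space std_normal_distribution std_normal_distribution
    by (rule pair_prob_space_std_normal)
  show ?thesis unfolding gauss_def by (intro prob_space_distr) simp
qed

lemma sets_gauss [simp, measurable_cong]: "sets gauss = sets borel"
  by (simp add: gauss_def)

lemma space_gauss [simp]: "space gauss = UNIV"
  by (simp add: gauss_def)

lemma gauss_product:
  fixes f g :: "real \<Rightarrow> complex"
  assumes f: "integrable std_normal_distribution f" and g: "integrable std_normal_distribution g"
  shows "integrable gauss (\<lambda>z. f (Re z) * g (Im z))" (is ?I)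
    and "(\<integral>z. f (Re z) * g (Im z) \<partial>gauss) = (\<integral>x. f x \<partial>std_normal_distribution) * (\<integral>x. g x \<partial>std_normal_distribution)" (is ?E)
proof -
  interpret pair_prob_space std_normal_distribution std_normal_distribution
    by (rule pair_prob_space_std_normal)
  have [measurable]: "f \<in> borel_measurable borel" "g \<in> borel_measurable borel"
    using borel_measurable_integrable[OF f] borel_measurable_integrable[OF g] by auto
  have int: "integrable (std_normal_distribution \<Otimes>\<^sub>M std_normal_distribution) (\<lambda>(x, y). f x * g y)"
    by (rule Fubini_integrable) (use f g in \<open>auto simp: norm_mult\<close>)
  then show ?I
    unfolding gauss_def by (subst integrable_distr_eq) (auto simp: split_def)
  have "(\<integral>z. f (Re z) * g (Im z) \<partial>gauss) = (\<integral>(x, y). f x * g y \<partial>(std_normal_distribution \<Otimes>\<^sub>M std_normal_distribution))"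
    unfolding gauss_def by (subst integral_distr) (auto simp: split_def)
  also have "\<dots> = (\<integral>x. (\<integral>y. f x * g y \<partial>std_normal_distribution) \<partial>std_normal_distribution)"
    using integral_fst[OF int] by simp
  also have "\<dots> = (\<integral>x. f x \<partial>std_normal_distribution) * (\<integral>x. g x \<partial>std_normal_distribution)"
    by simp
  finally show ?E .
qed

text \<open>Both the weight and the character split over coordinates, and the two square roots from
  dimension one combine to 1 + 2s. The case s = 0 represents a Gaussian as an average of characters;
  positive \<open>s\<close> evaluates the main term.\<close>

lemma gauss_exp_square_cis:
  assumes s: "s > -1/2"
  shows "integrable gauss (\<lambda>z. of_real (exp (- s * (norm z)\<^sup>2)) * cis (b * (z \<bullet> w)))"
    and "(\<integral>z. of_real (exp (- s * (norm z)\<^sup>2)) * cis (b * (z \<bullet> w)) \<partial>gauss) =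
      of_real (exp (- b\<^sup>2 * (norm w)\<^sup>2 / (2 * (1 + 2 * s))) / (1 + 2 * s))"
proof -
  let ?f = "\<lambda>v x. of_real (exp (- s * x\<^sup>2)) * cis (b * v * x)"
  have int: "integrable std_normal_distribution (?f v)" for v
  proof (rule Bochner_Integration.integrable_bound[OF integrable_std_normal_exp_square[OF s]])
    have "?f v \<in> borel_measurable borel"
      by (intro borel_measurable_continuous_onI continuous_intros)
    then show "?f v \<in> borel_measurable std_normal_distribution" by simp
  qed (auto simp: norm_mult)
  have eq: "(\<lambda>z. of_real (exp (- s * (norm z)\<^sup>2)) * cis (b * (z \<bullet> w))) = (\<lambda>z. ?f (Re w) (Re z) * ?f (Im w) (Im z))"
  proof
    fix z
    have "of_real (exp (- s * (norm z)\<^sup>2)) = complex_of_real (exp (- s * (Re z)\<^sup>2) * exp (- s * (Im z)\<^sup>2))"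
      by (simp add: cmod_power2 exp_add[symmetric] algebra_simps)
    moreover have "cis (b * (z \<bullet> w)) = cis (b * Re w * Re z) * cis (b * Im w * Im z)"
      by (simp add: cis_mult inner_complex_def algebra_simps)
    ultimately show "of_real (exp (- s * (norm z)\<^sup>2)) * cis (b * (z \<bullet> w)) = ?f (Re w) (Re z) * ?f (Im w) (Im z)"
      by simp
  qed
  show "integrable gauss (\<lambda>z. of_real (exp (- s * (norm z)\<^sup>2)) * cis (b * (z \<bullet> w)))"
    unfolding eq by (rule gauss_product(1)[OF int int])
  have sq: "sqrt (1 + 2 * s) * sqrt (1 + 2 * s) = 1 + 2 * s" using s by simp
  have ex: "exp (- (b * Re w)\<^sup>2 / (2 * (1 + 2 * s))) * exp (- (b * Im w)\<^sup>2 / (2 * (1 + 2 * s))) =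
     exp (- b\<^sup>2 * (norm w)\<^sup>2 / (2 * (1 + 2 * s)))"
    by (simp add: exp_add[symmetric] cmod_power2 add_divide_distrib[symmetric] diff_divide_distrib[symmetric] power_mult_distrib algebra_simps)
  show "(\<integral>z. of_real (exp (- s * (norm z)\<^sup>2)) * cis (b * (z \<bullet> w)) \<partial>gauss) =
      of_real (exp (- b\<^sup>2 * (norm w)\<^sup>2 / (2 * (1 + 2 * s))) / (1 + 2 * s))"
    unfolding eq gauss_product(2)[OF int int] integral_std_normal_exp_square_cis[OF s] of_real_mult[symmetric]
    by (simp only: times_divide_times_eq sq ex)
qed

lemma gauss_exp_square:
  assumes s: "s > -1/2"
  shows "integrable gauss (\<lambda>z. exp (- s * (norm z)\<^sup>2))"
    and "(\<integral>z. exp (- s * (norm z)\<^sup>2) \<partial>gauss) = 1 / (1 + 2 * s)"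
proof -
  have "integrable gauss (\<lambda>z. complex_of_real (exp (- s * (norm z)\<^sup>2)))"
    using gauss_exp_square_cis(1)[OF s, of 0 0] by simp
  then show "integrable gauss (\<lambda>z. exp (- s * (norm z)\<^sup>2))" by (simp only: complex_of_real_integrable_eq)
  have "complex_of_real (\<integral>z. exp (- s * (norm z)\<^sup>2) \<partial>gauss) = (\<integral>z. complex_of_real (exp (- s * (norm z)\<^sup>2)) \<partial>gauss)"
    by simp
  also have "\<dots> = of_real (1 / (1 + 2 * s))"
    using gauss_exp_square_cis(2)[OF s, of 0 0] by simp
  finally show "(\<integral>z. exp (- s * (norm z)\<^sup>2) \<partial>gauss) = 1 / (1 + 2 * s)" by (simp only: of_real_eq_iff)
qed

subsection \<open>The characteristic function of one Euler factor\<close>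

definition Lc :: "complex \<Rightarrow> complex" where
  "Lc z = - Ln (1 - z)"

text \<open>The radius 1 / sqrt 2 is |p^(-1/2 - it)| at the smallest prime. Being below 0.71, it
  makes the quadratic constant 1 / 0.29 < 4, and 1 + 0.71 / 0.29 < 4 gives the second bound.\<close>

lemma Lc_approx:
  assumes "norm z \<le> 1 / sqrt 2"
  shows "norm (Lc z - z) \<le> 4 * (norm z)\<^sup>2" "norm (Lc z) \<le> 4 * norm z"
proof -
  have s2: "1 / sqrt 2 \<le> (0.71 :: real)"
  proof -
    have "(1.41 :: real) \<le> sqrt 2" by (rule real_le_rsqrt) (simp add: power2_eq_square)
    then show ?thesis by (simp add: field_simps)
  qed
  with assms have z: "norm z \<le> 0.71" by simp
  have "norm (Ln (1 + (- z)) - (- z)) \<le> (norm (- z))\<^sup>2 / (1 - norm (- z))"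
    by (rule Ln_approx_linear) (use z in simp)
  moreover have "norm (Ln (1 + (- z)) - (- z)) = norm (Lc z - z)"
    by (simp add: Lc_def norm_minus_commute add.commute)
  ultimately have 1: "norm (Lc z - z) \<le> (norm z)\<^sup>2 / (1 - norm z)" by simp
  also have "\<dots> \<le> (norm z)\<^sup>2 / 0.29" using z by (intro divide_left_mono) auto
  also have "\<dots> = 1 / 0.29 * (norm z)\<^sup>2" by simp
  finally have 2: "norm (Lc z - z) \<le> 1 / 0.29 * (norm z)\<^sup>2" .
  also have "\<dots> \<le> 4 * (norm z)\<^sup>2" by (intro mult_right_mono) auto
  finally show "norm (Lc z - z) \<le> 4 * (norm z)\<^sup>2" .
  have "(norm z)\<^sup>2 \<le> 0.71 * norm z" using mult_right_mono[OF z norm_ge_zero[of z]] by (simp only: power2_eq_square)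
  then have "(norm z)\<^sup>2 * 100 \<le> 71 * norm z" by simp
  moreover have "norm (Lc z - z) * 29 \<le> 100 * (norm z)\<^sup>2" using 2 by simp
  ultimately show "norm (Lc z) \<le> 4 * norm z"
    using norm_triangle_ineq[of "Lc z - z" z] norm_ge_zero[of z] unfolding diff_add_cancel by linarith
qed

lemma Lc_nonpos: "norm z < 1 \<Longrightarrow> 1 - z \<notin> \<real>\<^sub>\<le>\<^sub>0" for z :: complex
  using complex_Re_le_cmod[of z] by (auto simp: complex_nonpos_Reals_iff)

lemma continuous_on_Lc [continuous_intros]:
  assumes "continuous_on S f" "\<And>x. x \<in> S \<Longrightarrow> norm (f x) < 1"
  shows "continuous_on S (\<lambda>x. Lc (f x))"
  unfolding Lc_def using assms by (intro continuous_intros) (auto simp: Lc_nonpos)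

lemma exp_Lc: "norm z < 1 \<Longrightarrow> exp (Lc z) = inverse (1 - z)"
  by (subst exp_Ln[of "1 - z", symmetric]) (auto simp: Lc_def exp_minus)

text \<open>Cauchy's formula gives the value at the centre, \<open>Lc 0 = 0\<close>. This removes
  the linear term from the expansion of \<open>psi\<close>.\<close>

lemma integral_Lc_circle:
  assumes "0 < u" "u < 1"
  shows "integral {0..1} (\<lambda>x. Lc (of_real u * cis (2 * pi * x))) = 0"
proof -
  have "((\<lambda>w. Lc w / (w - 0)) has_contour_integral (2 * of_real pi * \<i> * Lc 0)) (circlepath 0 u)"
  proof (rule Cauchy_integral_circlepath_simple)
    show "Lc holomorphic_on cball 0 u"
      unfolding Lc_def[abs_def] using assms
      by (intro holomorphic_intros) (auto intro!: Lc_nonpos)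
  qed (use assms in simp)
  then have "((\<lambda>x. Lc (circlepath 0 u x) / circlepath 0 u x * vector_derivative (circlepath 0 u) (at x within {0..1})) has_integral 0) {0..1}"
    by (simp add: has_contour_integral_def Lc_def)
  then have "((\<lambda>x. (2 * pi * \<i>) * Lc (of_real u * cis (2 * pi * x))) has_integral 0) {0..1}"
  proof (rule has_integral_eq[rotated])
    fix x :: real assume "x \<in> {0..1}"
    then have vd: "vector_derivative (circlepath 0 u) (at x within {0..1}) = 2 * pi * \<i> * u * exp (2 * of_real pi * \<i> * x)"
      by (intro vector_derivative_circlepath01) auto
    have c: "circlepath 0 u x = of_real u * cis (2 * pi * x)"
      by (simp add: circlepath cis_conv_exp mult_ac)
    have "exp (2 * of_real pi * \<i> * x) = cis (2 * pi * x)" by (simp add: cis_conv_exp mult_ac)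
    then show "Lc (circlepath 0 u x) / circlepath 0 u x * vector_derivative (circlepath 0 u) (at x within {0..1})
      = (2 * pi * \<i>) * Lc (of_real u * cis (2 * pi * x))"
      unfolding vd c using assms by simp
  qed
  then have "((\<lambda>x. (1 / (2 * pi * \<i>)) * ((2 * pi * \<i>) * Lc (of_real u * cis (2 * pi * x)))) has_integral (1 / (2 * pi * \<i>)) * 0) {0..1}"
    by (rule has_integral_mult_right)
  then show ?thesis by (simp add: integral_unique)
qed

definition psi :: "real \<Rightarrow> complex \<Rightarrow> complex" where
  "psi u \<xi> = integral {0..1} (\<lambda>x. cis (\<xi> \<bullet> Lc (of_real u * cis (2 * pi * x))))"

text \<open>Writing the inner product as Re w, its square is |w|^2 / 2 plus terms of frequency 2 and
  -2, which integrate to 0. Halved by the Taylor coefficient, this is the source of the 1/4 in exp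
  (-V |\<xi>|^2 / 4).\<close>

lemma integral_inner_circle_square:
  "integral {0..1} (\<lambda>x. (\<xi> \<bullet> (of_real u * cis (2 * pi * x)))\<^sup>2) = (norm \<xi>)\<^sup>2 * u\<^sup>2 / 2"
proof -
  define A where "A = cnj \<xi> ^ 2 * of_real (u\<^sup>2)"
  have eq: "complex_of_real ((\<xi> \<bullet> (of_real u * cis (2 * pi * x)))\<^sup>2) =
    trig_sum [(of_real ((norm \<xi>)\<^sup>2 * u\<^sup>2 / 2), 0), (A / 4, 2), (cnj A / 4, -2)] (2 * pi * x)" for x
  proof -
    define w where "w = cnj \<xi> * (of_real u * cis (2 * pi * x))"
    have "\<xi> \<bullet> (of_real u * cis (2 * pi * x)) = Re w"
      by (simp add: inner_complex_def w_def)
    then have "complex_of_real ((\<xi> \<bullet> (of_real u * cis (2 * pi * x)))\<^sup>2) = ((w + cnj w) / 2)\<^sup>2"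
      by (simp add: complex_add_cnj)
    also have "\<dots> = w * cnj w / 2 + w\<^sup>2 / 4 + cnj (w\<^sup>2) / 4"
      by (simp add: power2_eq_square field_simps)
    also have "w * cnj w = of_real ((norm \<xi>)\<^sup>2 * u\<^sup>2)"
      unfolding complex_norm_square[symmetric] by (simp add: w_def norm_mult power_mult_distrib)
    also have w2: "w\<^sup>2 = A * cis (2 * (2 * pi * x))"
      by (simp add: w_def A_def power_mult_distrib Complex.DeMoivre)
    also have "cnj (A * cis (2 * (2 * pi * x))) = cnj A * cis (- (2 * (2 * pi * x)))"
      by (simp add: cis_cnj)
    finally show ?thesis by (simp add: algebra_simps)
  qed
  have bl: "bounded_linear (of_real :: real \<Rightarrow> complex)" by (rule bounded_linear_of_real)
  have cont: "continuous_on {0..1} (\<lambda>x. (\<xi> \<bullet> (of_real u * cis (2 * pi * x)))\<^sup>2)"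
    by (intro continuous_intros)
  have "complex_of_real (integral {0..1} (\<lambda>x. (\<xi> \<bullet> (of_real u * cis (2 * pi * x)))\<^sup>2)) =
    integral {0..1} (\<lambda>x. complex_of_real ((\<xi> \<bullet> (of_real u * cis (2 * pi * x)))\<^sup>2))"
    using has_integral_linear[OF integrable_integral[OF integrable_continuous_real[OF cont]] bl]
    by (simp add: o_def integral_unique del: of_real_power)
  also have "\<dots> = of_real ((norm \<xi>)\<^sup>2 * u\<^sup>2 / 2)"
    unfolding eq integral_trig_sum by (simp add: trig_mean_def)
  finally show ?thesis by (simp only: of_real_eq_iff)
qed

lemma cis_taylor2: "norm (cis x - (1 + \<i> * of_real x - of_real (x\<^sup>2 / 2))) \<le> \<bar>x\<bar> ^ 3 / 6"
proof -
  have "(\<Sum>k\<le>2. (\<i> * of_real x) ^ k / fact k) = 1 + \<i> * of_real x - of_real (x\<^sup>2 / 2)"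
    by (simp add: eval_nat_numeral) (simp add: power2_eq_square[symmetric] algebra_simps)
  then show ?thesis using iexp_approx1[of x 2] by (simp add: cis_conv_exp eval_nat_numeral)
qed

text \<open>Expand \<open>cis\<close> to second order in \<xi> \<bullet> Lc z, then replace Lc z by
  z in the square. With |Lc z| \<le> 4u the cubic remainder is at most (4ku)^3 / 6 \<le> 11 k^3 u^3,
  where k = |\<xi>|, and the replacement costs half of (4ku^2)(5ku).\<close>

lemma psi_taylor:
  assumes u: "0 < u" "u \<le> 1 / sqrt 2"
  shows "norm (psi u \<xi> - of_real (1 - (norm \<xi>)\<^sup>2 * u\<^sup>2 / 4)) \<le> 11 * (norm \<xi>) ^ 3 * u ^ 3 + 10 * (norm \<xi>)\<^sup>2 * u ^ 3"
proof -
  let ?k = "norm \<xi>"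
  let ?z = "\<lambda>x. of_real u * cis (2 * pi * x)"
  have u1: "u < 1" using u(2) by (rule order.strict_trans1) (simp add: divide_less_eq)
  have nz: "norm (?z x) = u" for x using u by (simp add: norm_mult)
  have bl: "bounded_linear (of_real :: real \<Rightarrow> complex)" by (rule bounded_linear_of_real)
  define f where "f = (\<lambda>x. cis (\<xi> \<bullet> Lc (?z x)))"
  define l where "l = (\<lambda>x. \<xi> \<bullet> Lc (?z x))"
  define q where "q = (\<lambda>x. (\<xi> \<bullet> ?z x)\<^sup>2)"
  have contL: "continuous_on {0..1} (\<lambda>x. Lc (?z x))"
    by (intro continuous_intros) (use nz u1 in auto)
  have contl: "continuous_on {0..1} l" unfolding l_def by (intro continuous_intros contL)
  have contf: "continuous_on {0..1} f" unfolding f_def by (intro continuous_intros contL)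
  have contq: "continuous_on {0..1} q" unfolding q_def by (intro continuous_intros)
  have bnd: "norm (f x - (1 + \<i> * of_real (l x) - of_real (q x / 2))) \<le> 11 * ?k ^ 3 * u ^ 3 + 10 * ?k\<^sup>2 * u ^ 3" for x
  proof -
    have L: "norm (Lc (?z x) - ?z x) \<le> 4 * u\<^sup>2" "norm (Lc (?z x)) \<le> 4 * u"
      using Lc_approx[of "?z x"] u by (simp_all add: nz)
    have l: "\<bar>l x\<bar> \<le> ?k * (4 * u)"
      unfolding l_def by (rule order_trans[OF Cauchy_Schwarz_ineq2]) (intro mult_left_mono L; simp)
    have s: "\<bar>\<xi> \<bullet> ?z x\<bar> \<le> ?k * u"
      by (rule order_trans[OF Cauchy_Schwarz_ineq2]) (simp add: nz)
    have d: "\<bar>l x - \<xi> \<bullet> ?z x\<bar> \<le> ?k * (4 * u\<^sup>2)"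
      unfolding l_def inner_diff_right[symmetric]
      by (rule order_trans[OF Cauchy_Schwarz_ineq2]) (intro mult_left_mono L; simp)
    have "\<bar>(l x)\<^sup>2 - q x\<bar> = \<bar>l x - \<xi> \<bullet> ?z x\<bar> * \<bar>l x + \<xi> \<bullet> ?z x\<bar>"
      by (simp add: q_def abs_mult[symmetric] power2_eq_square algebra_simps)
    also have "\<dots> \<le> (?k * (4 * u\<^sup>2)) * (5 * ?k * u)"
      using d l s u by (intro mult_mono) auto
    also have "\<dots> = 20 * ?k\<^sup>2 * u ^ 3" by (simp add: power2_eq_square power3_eq_cube)
    finally have sq: "\<bar>(l x)\<^sup>2 - q x\<bar> \<le> 20 * ?k\<^sup>2 * u ^ 3" .
    have "\<bar>l x\<bar> ^ 3 \<le> (?k * (4 * u)) ^ 3" using l by (intro power_mono) auto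
    also have "\<dots> = 64 * ?k ^ 3 * u ^ 3" by (simp add: power_mult_distrib)
    finally have cu: "\<bar>l x\<bar> ^ 3 \<le> 64 * ?k ^ 3 * u ^ 3" .
    have "f x - (1 + \<i> * of_real (l x) - of_real (q x / 2)) =
      (cis (l x) - (1 + \<i> * of_real (l x) - of_real ((l x)\<^sup>2 / 2))) - of_real (((l x)\<^sup>2 - q x) / 2)"
      by (simp add: f_def l_def field_simps)
    also have "norm \<dots> \<le> \<bar>l x\<bar> ^ 3 / 6 + \<bar>((l x)\<^sup>2 - q x) / 2\<bar>"
      by (rule order_trans[OF norm_triangle_ineq4 add_mono[OF cis_taylor2]]) (simp only: norm_of_real order_refl)
    also have "\<dots> \<le> (64 * ?k ^ 3 * u ^ 3) / 6 + 10 * ?k\<^sup>2 * u ^ 3"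
      by (rule add_mono) (use sq cu in \<open>auto simp: mult_ac\<close>)
    also have "\<dots> \<le> 11 * ?k ^ 3 * u ^ 3 + 10 * ?k\<^sup>2 * u ^ 3" using u by simp
    finally show ?thesis .
  qed
  have "(l has_integral 0) {0..1}"
  proof -
    have "((\<lambda>x. Lc (?z x)) has_integral 0) {0..1}"
      using integral_Lc_circle[OF u(1) u1] integrable_integral[OF integrable_continuous_real[OF contL]] by simp
    from has_integral_linear[OF this bounded_linear_inner_right[of \<xi>]]
    show ?thesis by (simp add: l_def o_def)
  qed
  then have hl: "((\<lambda>x. \<i> * of_real (l x)) has_integral 0) {0..1}"
    using has_integral_linear[OF has_integral_linear[OF _ bl] bounded_linear_mult_right[of \<i>], of l 0 "{0..1}"]
    by (simp add: o_def)
  have "(q has_integral (?k\<^sup>2 * u\<^sup>2 / 2)) {0..1}"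
    using integrable_integral[OF integrable_continuous_real[OF contq]]
    unfolding q_def integral_inner_circle_square .
  then have "((\<lambda>x. q x / 2) has_integral (?k\<^sup>2 * u\<^sup>2 / 4)) {0..1}"
    using has_integral_divide[of q "?k\<^sup>2 * u\<^sup>2 / 2" "{0..1}" 2] by simp
  from has_integral_linear[OF this bl] have hq: "((\<lambda>x. complex_of_real (q x / 2)) has_integral of_real (?k\<^sup>2 * u\<^sup>2 / 4)) {0..1}"
    by (simp only: o_def)
  have h1: "((\<lambda>x. 1) has_integral (1 :: complex)) {0..1::real}"
    using has_integral_const_real[of "1::complex" 0 1] by simp
  have hf: "(f has_integral psi u \<xi>) {0..1}"
    using integrable_integral[OF integrable_continuous_real[OF contf]] by (simp add: psi_def f_def)
  have "((\<lambda>x. f x - (1 + \<i> * of_real (l x) - of_real (q x / 2))) has_integral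
      (psi u \<xi> - (1 + 0 - of_real (?k\<^sup>2 * u\<^sup>2 / 4)))) (cbox 0 1)"
    using has_integral_diff[OF hf has_integral_diff[OF has_integral_add[OF h1 hl] hq]] by simp
  from has_integral_bound[OF _ this, of "11 * ?k ^ 3 * u ^ 3 + 10 * ?k\<^sup>2 * u ^ 3"] bnd u
  show ?thesis by simp
qed

lemma psi_le_1: 
  assumes "0 < u" "u < 1"
  shows "norm (psi u \<xi>) \<le> 1"
proof -
  have "continuous_on {0..1} (\<lambda>x. cis (\<xi> \<bullet> Lc (of_real u * cis (2 * pi * x))))"
    by (intro continuous_intros) (use assms in \<open>auto simp: norm_mult\<close>)
  from integral_bound[OF _ this, of 1] show ?thesis by (simp add: psi_def)
qed

lemma continuous_psi: 
  assumes "0 < u" "u < 1"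
  shows "continuous_on UNIV (psi u)"
  unfolding psi_def[abs_def] interval_cbox
proof (rule integral_continuous_on_param)
  have "continuous_on (UNIV \<times> cbox 0 1) (\<lambda>y. cis (fst y \<bullet> Lc (of_real u * cis (2 * pi * snd y))))"
    by (intro continuous_intros) (use assms in \<open>auto simp: norm_mult\<close>)
  then show "continuous_on (UNIV \<times> cbox 0 1) (\<lambda>(\<xi>, x). cis (\<xi> \<bullet> Lc (complex_of_real u * cis (2 * pi * x))))"
    by (simp add: case_prod_beta)
qed

subsection \<open>The characteristic function of the Euler product\<close>

definition phi :: "nat \<Rightarrow> complex \<Rightarrow> complex" where
  "phi N \<xi> = (\<Prod>p\<in>primes_upto N. psi (1 / sqrt (real p)) \<xi>)"

lemma prime_inv_sqrt:
  assumes "prime (p :: nat)"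
  shows "0 < 1 / sqrt (real p)" "1 / sqrt (real p) \<le> 1 / sqrt 2" "1 / sqrt (real p) < 1" "(1 / sqrt (real p))\<^sup>2 = 1 / real p"
proof -
  have p: "real p \<ge> 2" using prime_ge_2_nat[OF assms] by simp
  then have "sqrt (real p) \<ge> sqrt 2" by simp
  moreover have "sqrt 2 > (1::real)" by simp
  ultimately have "sqrt 2 \<le> sqrt (real p)" "1 < sqrt (real p)" by linarith+
  then show "1 / sqrt (real p) \<le> 1 / sqrt 2" "1 / sqrt (real p) < 1"
    using p by (auto intro: divide_left_mono)
  show "0 < 1 / sqrt (real p)" "(1 / sqrt (real p))\<^sup>2 = 1 / real p" using p by (auto simp: power_divide)
qed

text \<open>The Taylor error equals k^2 u^2 times (11k + 10) u. The threshold on p makes the latter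
  at most 1/8, half of the coefficient 1/4 of the decrease.\<close>

lemma psi_decay:
  assumes p: "prime p" and large: "real p \<ge> 64 * (11 * norm \<xi> + 10)\<^sup>2"
  shows "norm (psi (1 / sqrt (real p)) \<xi>) \<le> exp (- (norm \<xi>)\<^sup>2 / 8 * (1 / real p))"
proof -
  define u where "u = 1 / sqrt (real p)"
  define k where "k = norm \<xi>"
  have k: "k \<ge> 0" by (simp add: k_def)
  have u: "u > 0" "u \<le> 1 / sqrt 2" "u\<^sup>2 = 1 / real p" using prime_inv_sqrt[OF p] by (auto simp: u_def)
  have "8 * (11 * k + 10) \<le> sqrt (real p)"
    by (intro real_le_rsqrt, subst power_mult_distrib) (use large in \<open>simp add: k_def\<close>)
  then have uk: "(11 * k + 10) * u \<le> 1 / 8" using p by (simp add: u_def field_simps prime_gt_0_nat)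
  then have "k * u \<le> 1" using k u(1) mult_nonneg_nonneg[OF k less_imp_le[OF u(1)]] by (simp add: algebra_simps)
  then have "(k * u)\<^sup>2 \<le> 1" using k u by (simp add: power_le_one)
  then have ku: "k\<^sup>2 * u\<^sup>2 \<le> 1" by (simp add: power_mult_distrib)
  have "norm (psi u \<xi>) \<le> norm (complex_of_real (1 - k\<^sup>2 * u\<^sup>2 / 4)) + (11 * k ^ 3 * u ^ 3 + 10 * k\<^sup>2 * u ^ 3)"
    using psi_taylor[OF u(1,2), of \<xi>] norm_triangle_ineq[of "complex_of_real (1 - k\<^sup>2 * u\<^sup>2 / 4)" "psi u \<xi> - of_real (1 - k\<^sup>2 * u\<^sup>2 / 4)"]
    by (simp add: k_def)
  also have "norm (complex_of_real (1 - k\<^sup>2 * u\<^sup>2 / 4)) = 1 - k\<^sup>2 * u\<^sup>2 / 4" 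
    unfolding norm_of_real using ku by simp
  also have "11 * k ^ 3 * u ^ 3 + 10 * k\<^sup>2 * u ^ 3 = k\<^sup>2 * u\<^sup>2 * ((11 * k + 10) * u)"
    by (simp add: power2_eq_square power3_eq_cube algebra_simps)
  also have "\<dots> \<le> k\<^sup>2 * u\<^sup>2 * (1 / 8)" using uk by (intro mult_left_mono) auto
  finally have "norm (psi u \<xi>) \<le> 1 + (- (k\<^sup>2 * u\<^sup>2 / 8))" by simp
  also have "\<dots> \<le> exp (- (k\<^sup>2 * u\<^sup>2 / 8))" by (rule exp_ge_add_one_self)
  finally have "norm (psi u \<xi>) \<le> exp (- (k\<^sup>2 * u\<^sup>2 / 8))" .
  moreover have "- (k\<^sup>2 * u\<^sup>2 / 8) = - k\<^sup>2 / 8 * (1 / real p)" unfolding u(3) by simp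
  ultimately show ?thesis unfolding u_def k_def by (simp only:)
qed

text \<open>Primes up to \<open>M\<close>, for which the Taylor expansion may be useless, are bounded trivially.\<close>

definition majorant :: "real \<Rightarrow> nat \<Rightarrow> nat \<Rightarrow> real" where
  "majorant k M p = (if p > M then exp (- k\<^sup>2 / 8 * (1 / real p)) else 1)"

lemma majorant_pos: "majorant k M p > 0" by (simp add: majorant_def)

lemma psi_le_majorant:
  assumes "prime p" "real M \<ge> 64 * (11 * norm \<xi> + 10)\<^sup>2"
  shows "norm (psi (1 / sqrt (real p)) \<xi>) \<le> majorant (norm \<xi>) M p"
proof (cases "p > M")
  case True
  then have "real p \<ge> 64 * (11 * norm \<xi> + 10)\<^sup>2" using assms(2) by linarith
  from psi_decay[OF assms(1) this] True show ?thesis unfolding majorant_def by (simp only: if_True)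
next
  case False
  with psi_le_1[OF prime_inv_sqrt(1,3)[OF assms(1)]] show ?thesis unfolding majorant_def by (simp only: if_False)
qed

text \<open>The Gaussian factor must lie below the same majorant as \<open>psi\<close> for
  \<open>norm_prod_diff_scaled\<close> to apply.\<close>

lemma exp_le_majorant: "exp (- k\<^sup>2 / 4 * (1 / real p)) \<le> majorant k M p"
proof -
  have "k\<^sup>2 * (1 / real p) \<ge> 0" by simp
  then have "- k\<^sup>2 / 4 * (1 / real p) \<le> - k\<^sup>2 / 8 * (1 / real p)" "- k\<^sup>2 / 4 * (1 / real p) \<le> 0"
    by linarith+
  then show ?thesis unfolding majorant_def by (simp only: exp_le_cancel_iff exp_le_one_iff split: if_split) simp
qed

text \<open>The primes in (M, N] carry at least half of \<open>prime_recip N\<close>, so the rate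
  1/8 drops only to 1/16.\<close>

lemma prod_majorant_le:
  assumes "prime_recip M \<le> prime_recip N / 2"
  shows "(\<Prod>p\<in>primes_upto N. majorant k M p) \<le> exp (- k\<^sup>2 * prime_recip N / 16)"
proof -
  let ?A = "{p \<in> primes_upto N. p > M}"
  have "(\<Prod>p\<in>primes_upto N. majorant k M p) = (\<Prod>p\<in>?A. exp (- k\<^sup>2 / 8 * (1 / real p)))"
    unfolding majorant_def by (subst prod.inter_filter[symmetric]) auto
  also have "\<dots> = exp (- k\<^sup>2 / 8 * (\<Sum>p\<in>?A. 1 / real p))"
    unfolding sum_distrib_left by (rule exp_sum[symmetric]) simp
  also have "\<dots> \<le> exp (- k\<^sup>2 / 8 * (prime_recip N / 2))"
  proof -
    have "prime_recip N = (\<Sum>p\<in>?A. 1 / real p) + (\<Sum>p\<in>primes_upto N - ?A. 1 / real p)"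
      unfolding prime_recip_def by (subst sum.subset_diff[of ?A]) auto
    moreover have "(\<Sum>p\<in>primes_upto N - ?A. 1 / real p) \<le> prime_recip M"
      unfolding prime_recip_def by (rule sum_mono2) (auto simp: primes_upto_def)
    ultimately have "prime_recip N / 2 \<le> (\<Sum>p\<in>?A. 1 / real p)" using assms by simp
    then have "k\<^sup>2 / 8 * (prime_recip N / 2) \<le> k\<^sup>2 / 8 * (\<Sum>p\<in>?A. 1 / real p)"
      by (rule mult_left_mono) simp
    then show ?thesis by simp
  qed
  finally show ?thesis by simp
qed

lemma norm_phi_le:
  assumes "prime_recip M \<le> prime_recip N / 2" "real M \<ge> 64 * (11 * norm \<xi> + 10)\<^sup>2"
  shows "norm (phi N \<xi>) \<le> exp (- (norm \<xi>)\<^sup>2 * prime_recip N / 16)"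
proof -
  have "norm (phi N \<xi>) \<le> (\<Prod>p\<in>primes_upto N. majorant (norm \<xi>) M p)"
    unfolding phi_def prod_norm[symmetric]
    by (intro prod_mono conjI psi_le_majorant assms) (auto dest: primes_upto_prime)
  also have "\<dots> \<le> exp (- (norm \<xi>)\<^sup>2 * prime_recip N / 16)" by (rule prod_majorant_le[OF assms(1)])
  finally show ?thesis .
qed

lemma norm_phi_le_1: "norm (phi N \<xi>) \<le> 1"
  unfolding phi_def prod_norm[symmetric]
  by (intro prod_le_1) (auto intro!: psi_le_1 prime_inv_sqrt dest: primes_upto_prime)

lemma continuous_phi: "continuous_on UNIV (phi N)"
  unfolding phi_def[abs_def]
  by (intro continuous_on_prod continuous_psi prime_inv_sqrt) (auto dest: primes_upto_prime)

text \<open>Dividing the factors by \<open>B i\<close> brings them into the unit disc, where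
  \<open>norm_prod_diff\<close> applies; multiplying back retains the decay of the product of the
  \<open>B i\<close>.\<close>

lemma norm_prod_diff_scaled:
  fixes a b :: "'i \<Rightarrow> complex"
  assumes B: "\<And>i. i \<in> I \<Longrightarrow> B i > 0"
    and a: "\<And>i. i \<in> I \<Longrightarrow> norm (a i) \<le> B i" and b: "\<And>i. i \<in> I \<Longrightarrow> norm (b i) \<le> B i"
  shows "norm ((\<Prod>i\<in>I. a i) - (\<Prod>i\<in>I. b i)) \<le> (\<Sum>i\<in>I. norm (a i - b i) / B i) * (\<Prod>i\<in>I. B i)"
proof -
  have eq: "(\<Prod>i\<in>I. c i) = (\<Prod>i\<in>I. c i / of_real (B i)) * of_real (\<Prod>i\<in>I. B i)" for c :: "'i \<Rightarrow> complex"
    unfolding of_real_prod prod.distrib[symmetric] using B by (intro prod.cong) force+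
  have "(\<Prod>i\<in>I. a i) - (\<Prod>i\<in>I. b i) = ((\<Prod>i\<in>I. a i / of_real (B i)) - (\<Prod>i\<in>I. b i / of_real (B i))) * of_real (\<Prod>i\<in>I. B i)"
    by (subst eq[of a], subst eq[of b]) (simp add: algebra_simps)
  also have "norm \<dots> = norm ((\<Prod>i\<in>I. a i / of_real (B i)) - (\<Prod>i\<in>I. b i / of_real (B i))) * (\<Prod>i\<in>I. B i)"
  proof -
    have "(\<Prod>i\<in>I. B i) \<ge> 0" using B by (intro prod_nonneg) (auto intro: less_imp_le)
    then show ?thesis unfolding norm_mult norm_of_real by simp
  qed
  also have "norm ((\<Prod>i\<in>I. a i / of_real (B i)) - (\<Prod>i\<in>I. b i / of_real (B i))) \<le>
     (\<Sum>i\<in>I. norm (a i / of_real (B i) - b i / of_real (B i)))"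
  proof (rule norm_prod_diff)
    fix i assume "i \<in> I"
    then show "norm (a i / of_real (B i)) \<le> 1" "norm (b i / of_real (B i)) \<le> 1"
      using a[of i] b[of i] B[of i] by (auto simp: norm_divide divide_le_eq)
  qed
  also have "\<dots> = (\<Sum>i\<in>I. norm (a i - b i) / B i)"
    using B by (intro sum.cong refl) (force simp: norm_divide diff_divide_distrib[symmetric])
  finally show ?thesis using B by (auto intro: mult_right_mono prod_nonneg less_imp_le)
qed

lemma exp_minus_approx: "\<bar>exp (- x) - (1 - x)\<bar> \<le> x\<^sup>2" if "x \<ge> 0" for x :: real
proof -
  have "exp (- x) \<ge> 1 - x" using exp_ge_add_one_self[of "- x"] by simp
  moreover have "exp (- x) \<le> 1 / (1 + x)"
    using exp_ge_add_one_self[of x] that by (simp add: exp_minus field_simps)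
  moreover have "1 / (1 + x) \<le> 1 - x + x\<^sup>2"
  proof -
    have "(1 - x + x\<^sup>2) * (1 + x) = 1 + x ^ 3" by (simp add: power2_eq_square power3_eq_cube algebra_simps)
    then show ?thesis using that by (simp add: divide_le_eq)
  qed
  ultimately show ?thesis by linarith
qed

text \<open>For |\<xi>| \<le> 1 all error terms are absorbed into |\<xi>|^2 u^3. The factor
  |\<xi>|^2 matters: against the Gaussian decay it is worth 1 / V.\<close>

lemma psi_gauss_diff:
  assumes p: "prime p" and k: "norm \<xi> \<le> 1"
  shows "norm (psi (1 / sqrt (real p)) \<xi> - of_real (exp (- (norm \<xi>)\<^sup>2 / 4 * (1 / real p)))) \<le> 22 * (norm \<xi>)\<^sup>2 * (1 / sqrt (real p) ^ 3)"
proof -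
  define u where "u = 1 / sqrt (real p)"
  define k where "k = norm \<xi>"
  define x where "x = k\<^sup>2 * u\<^sup>2 / 4"
  have u: "u > 0" "u \<le> 1 / sqrt 2" "u < 1" "u\<^sup>2 = 1 / real p" using prime_inv_sqrt[OF p] by (auto simp: u_def)
  have k1: "0 \<le> k" "k \<le> 1" using k by (auto simp: k_def)
  have k3: "k ^ 3 \<le> k\<^sup>2" "k ^ 4 \<le> k\<^sup>2" using k1 by (auto intro: power_decreasing)
  have u4: "u ^ 4 \<le> u ^ 3" using u by (intro power_decreasing) auto
  have "x\<^sup>2 = k ^ 4 * u ^ 4 / 16" by (simp add: x_def power_divide power_mult_distrib flip: power_mult)
  also have "\<dots> \<le> k\<^sup>2 * u ^ 3 / 16" using k3 u4 u k1 by (intro divide_right_mono mult_mono) auto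
  finally have x2: "x\<^sup>2 \<le> k\<^sup>2 * u ^ 3 / 16" .
  have "norm (psi u \<xi> - of_real (exp (- x))) \<le> norm (psi u \<xi> - of_real (1 - x)) + norm (complex_of_real (exp (- x)) - of_real (1 - x))"
    by (rule order_trans[OF _ norm_triangle_ineq4]) simp
  also have "norm (complex_of_real (exp (- x)) - of_real (1 - x)) \<le> k\<^sup>2 * u ^ 3 / 16"
    unfolding of_real_diff[symmetric] norm_of_real using exp_minus_approx[of x] x2 by (simp add: x_def)
  also have "norm (psi u \<xi> - of_real (1 - x)) \<le> 11 * k ^ 3 * u ^ 3 + 10 * k\<^sup>2 * u ^ 3"
    using psi_taylor[OF u(1,2), of \<xi>] by (simp add: k_def x_def)
  also have "11 * k ^ 3 * u ^ 3 \<le> 11 * k\<^sup>2 * u ^ 3" using k3 u by (intro mult_right_mono) auto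
  finally have "norm (psi u \<xi> - of_real (exp (- x))) \<le> 11 * k\<^sup>2 * u ^ 3 + 10 * k\<^sup>2 * u ^ 3 + k\<^sup>2 * u ^ 3 / 16" by simp
  also have "\<dots> \<le> 22 * k\<^sup>2 * u ^ 3" using u by simp
  finally have "norm (psi u \<xi> - of_real (exp (- x))) \<le> 22 * k\<^sup>2 * u ^ 3" .
  moreover have "- x = - k\<^sup>2 / 4 * (1 / real p)" unfolding x_def u(4) by simp
  moreover have "u ^ 3 = 1 / sqrt (real p) ^ 3" by (simp add: u_def power_one_over)
  ultimately show ?thesis unfolding u_def k_def by (simp only:)
qed

section \<open>Comparison of \<open>phi\<close> with the Gaussian up to frequency V^3\<close>

lemma ln_le_thousandth:
  assumes "x \<ge> (10 :: real) ^ 8"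
  shows "ln x \<le> x / 1000"
proof -
  have s: "sqrt x \<ge> 10000" using assms by (intro real_le_rsqrt) simp
  then have spos: "sqrt x > 0" by linarith
  have "ln x = 2 * ln (sqrt x)" using assms by (simp add: ln_sqrt)
  also have "\<dots> \<le> 2 * sqrt x" using ln_le_minus_one[OF spos] by linarith
  also have "\<dots> \<le> sqrt x / 1000 * sqrt x" using s spos by (intro mult_right_mono) linarith+
  also have "\<dots> = x / 1000" using assms by simp
  finally show ?thesis .
qed

text \<open>Used to trade part of an exponential decay for an inverse power.\<close>

lemma mult_exp_neg_le: "x * exp (- x) \<le> 1" for x :: real
proof -
  have "x \<le> exp x" using exp_ge_add_one_self[of x] by linarith
  then show ?thesis by (simp add: exp_minus field_simps)
qed

text \<open>The error has to be smaller than the Gaussian by a factor 1 / V and still integrable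
  with the same scaling in \<open>V\<close>, hence the exponential at a reduced rate. Up to |\<xi>|
  = 1 it comes from summing \<open>psi_gauss_diff\<close>; beyond 1 each of the two terms is
  separately small.\<close>

lemma phi_gauss_approx:
  assumes V: "prime_recip N \<ge> 10 ^ 8" and k: "norm \<xi> \<le> prime_recip N ^ 3"
  shows "norm (phi N \<xi> - of_real (exp (- (norm \<xi>)\<^sup>2 * prime_recip N / 4)))
    \<le> 4224 / prime_recip N * exp (- (norm \<xi>)\<^sup>2 * prime_recip N / 32)"
proof -
  define V where "V = prime_recip N"
  define k where "k = norm \<xi>"
  have V8: "V \<ge> 10 ^ 8" using V by (simp add: V_def)
  then have Vpos: "V > 0" by simp
  have k0: "k \<ge> 0" by (simp add: k_def)
  show ?thesis
  proof (cases "k \<le> 1")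
    case True
    \<comment> \<open>28224 = 64 * 21^2 is the threshold of \<open>psi_decay\<close> at |\<xi>| =
      1.\<close>
    define B where "B = majorant k 28224"
    have M: "real 28224 \<ge> 64 * (11 * norm \<xi> + 10)\<^sup>2"
    proof -
      have "(11 * k + 10)\<^sup>2 \<le> 21\<^sup>2" using True k0 by (intro power_mono) auto
      then show ?thesis by (simp add: k_def)
    qed
    have "prime_recip 28224 \<le> 1 + ln (real 28224)" by (rule prime_recip_le_ln) simp
    also have "\<dots> \<le> V / 2" using ln_le_minus_one[of "real 28224"] V8 by simp
    finally have half: "prime_recip 28224 \<le> prime_recip N / 2" by (simp add: V_def)
    \<comment> \<open>Dividing a single error by its majorant therefore at most doubles it, from 22
      to 44.\<close>
    have Bhalf: "B p \<ge> 1 / 2" if "prime p" for p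
    proof -
      have "k\<^sup>2 \<le> 1" using True k0 by (simp add: power_le_one)
      moreover have "1 / real p \<le> 1" using prime_ge_1_nat[OF that] by simp
      ultimately have "k\<^sup>2 * (1 / real p) \<le> 1 * 1" by (intro mult_mono) auto
      then have "1 / 2 \<le> 1 + (- k\<^sup>2 / 8 * (1 / real p))" by simp
      also have "\<dots> \<le> exp (- k\<^sup>2 / 8 * (1 / real p))" by (rule exp_ge_add_one_self)
      finally show ?thesis by (simp add: B_def majorant_def)
    qed
    have eq: "complex_of_real (exp (- k\<^sup>2 * V / 4)) = (\<Prod>p\<in>primes_upto N. of_real (exp (- k\<^sup>2 / 4 * (1 / real p))))"
      unfolding of_real_prod[symmetric] exp_sum[OF finite_primes_upto, symmetric]
      unfolding V_def prime_recip_def sum_distrib_left[symmetric] by simp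
    have "norm (phi N \<xi> - of_real (exp (- k\<^sup>2 * V / 4))) \<le>
      (\<Sum>p\<in>primes_upto N. norm (psi (1 / sqrt (real p)) \<xi> - of_real (exp (- k\<^sup>2 / 4 * (1 / real p)))) / B p) * (\<Prod>p\<in>primes_upto N. B p)"
      unfolding eq phi_def
    proof (rule norm_prod_diff_scaled)
      fix p assume "p \<in> primes_upto N"
      then have "prime p" by (rule primes_upto_prime)
      then show "0 < B p" "norm (psi (1 / sqrt (real p)) \<xi>) \<le> B p" "norm (complex_of_real (exp (- k\<^sup>2 / 4 * (1 / real p)))) \<le> B p"
        using psi_le_majorant[OF _ M, of p] exp_le_majorant[of k p] by (simp_all add: B_def majorant_pos k_def)
    qed
    also have "\<dots> \<le> (\<Sum>p\<in>primes_upto N. 44 * k\<^sup>2 * (1 / sqrt (real p) ^ 3)) * exp (- k\<^sup>2 * V / 16)"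
    proof (intro mult_mono sum_mono)
      fix p assume "p \<in> primes_upto N"
      then have p: "prime p" by (rule primes_upto_prime)
      have "norm (psi (1 / sqrt (real p)) \<xi> - of_real (exp (- k\<^sup>2 / 4 * (1 / real p)))) / B p
         \<le> (22 * k\<^sup>2 * (1 / sqrt (real p) ^ 3)) / (1 / 2)"
        using psi_gauss_diff[OF p, of \<xi>] True Bhalf[OF p] by (intro frac_le) (auto simp: k_def)
      then show "norm (psi (1 / sqrt (real p)) \<xi> - of_real (exp (- k\<^sup>2 / 4 * (1 / real p)))) / B p \<le> 44 * k\<^sup>2 * (1 / sqrt (real p) ^ 3)" by simp
    qed (use prod_majorant_le[OF half, of k] in \<open>auto simp: B_def V_def intro!: sum_nonneg prod_nonneg less_imp_le[OF majorant_pos]\<close>)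
    also have "\<dots> \<le> (44 * k\<^sup>2 * 3) * exp (- k\<^sup>2 * V / 16)"
      unfolding sum_distrib_left[symmetric]
      by (intro mult_right_mono mult_left_mono sum_primes_three_halves) auto
    \<comment> \<open>4224 = 44 * 3 * 32. Half of the exponent is spent on cancelling k^2.\<close>
    also have "\<dots> = 4224 / V * ((k\<^sup>2 * V / 32) * exp (- (k\<^sup>2 * V / 32))) * exp (- k\<^sup>2 * V / 32)"
    proof -
      have "exp (- k\<^sup>2 * V / 16) = exp (- (k\<^sup>2 * V / 32)) * exp (- k\<^sup>2 * V / 32)" by (simp add: exp_add[symmetric])
      then show ?thesis using Vpos by simp
    qed
    also have "\<dots> \<le> 4224 / V * 1 * exp (- k\<^sup>2 * V / 32)"
      using Vpos by (intro mult_right_mono mult_left_mono mult_exp_neg_le) auto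
    finally show ?thesis by (simp add: k_def V_def)
  next
    case False
    \<comment> \<open>Here 11k + 10 \<le> 21 V^3, so the threshold is 64 * 21^2 * V^6; 28225 absorbs
      the rounding. Being polynomial in \<open>V\<close>, the cut-off loses only O(log V) of the sum
      of reciprocals.\<close>
    define M where "M = nat \<lceil>28224 * V ^ 6\<rceil>"
    have V6: "V ^ 6 \<ge> 1" using V8 by (intro one_le_power) simp
    have M1: "real M \<ge> 28224 * V ^ 6" "real M \<le> 28225 * V ^ 6"
      unfolding M_def using V6 by linarith+
    have "prime_recip M \<le> 1 + ln (real M)" using M1 V6 by (intro prime_recip_le_ln) linarith
    also have "\<dots> \<le> 1 + ln (28225 * V ^ 6)" using M1 V6 by (intro add_left_mono ln_mono) linarith+
    also have "\<dots> = 1 + ln 28225 + 6 * ln V" using Vpos by (simp add: ln_mult ln_realpow)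
    also have "\<dots> \<le> V / 2" using ln_le_thousandth[OF V8] ln_le_minus_one[of "28225::real"] V8 by simp
    finally have half: "prime_recip M \<le> prime_recip N / 2" by (simp add: V_def)
    have large: "real M \<ge> 64 * (11 * norm \<xi> + 10)\<^sup>2"
    proof -
      have "11 * k + 10 \<le> 21 * V ^ 3" using False k by (simp add: k_def V_def)
      then have "(11 * k + 10)\<^sup>2 \<le> (21 * V ^ 3)\<^sup>2" using k0 by (intro power_mono) auto
      also have "\<dots> = 441 * V ^ 6" by (simp add: power_mult_distrib flip: power_mult)
      finally show ?thesis using M1 by (simp add: k_def)
    qed
    have "norm (phi N \<xi> - of_real (exp (- k\<^sup>2 * V / 4))) \<le> norm (phi N \<xi>) + exp (- k\<^sup>2 * V / 4)"
      by (rule order_trans[OF norm_triangle_ineq4]) simp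
    also have "norm (phi N \<xi>) \<le> exp (- k\<^sup>2 * V / 16)"
      using norm_phi_le[OF half large] by (simp add: k_def V_def)
    also have "exp (- k\<^sup>2 * V / 4) \<le> exp (- k\<^sup>2 * V / 16)" using Vpos by simp
    also have "exp (- k\<^sup>2 * V / 16) + exp (- k\<^sup>2 * V / 16) = 2 * exp (- (k\<^sup>2 * V / 32)) * exp (- k\<^sup>2 * V / 32)"
      by (simp add: exp_add[symmetric])
    also have "\<dots> \<le> 2 * (32 / V) * exp (- k\<^sup>2 * V / 32)"
    proof (intro mult_right_mono mult_left_mono)
      have "V / 32 \<le> k\<^sup>2 * V / 32" using False Vpos by (simp add: one_le_power)
      then have "exp (- (k\<^sup>2 * V / 32)) \<le> exp (- (V / 32))" by simp
      also have "\<dots> \<le> 32 / V" using mult_exp_neg_le[of "V / 32"] Vpos by (simp add: field_simps)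
      finally show "exp (- (k\<^sup>2 * V / 32)) \<le> 32 / V" .
    qed auto
    also have "\<dots> \<le> 4224 / V * exp (- k\<^sup>2 * V / 32)"
      using Vpos by (intro mult_right_mono) (auto simp: field_simps)
    finally show ?thesis by (simp add: k_def V_def)
  qed
qed

subsection \<open>Gaussian test functions\<close>

text \<open>The limit of the time averages of exp (-a |log_P N t - w|^2), computed on the Fourier
  side. The scale sqrt (2a) arises because averaging cis (b (z \<bullet> x)) gives exp (-b^2 |x|^2 /
  2).\<close>

definition gauss_phi :: "nat \<Rightarrow> real \<Rightarrow> complex \<Rightarrow> complex" where
  "gauss_phi N a w = (\<integral>z. phi N (sqrt (2 * a) *\<^sub>R z) * cis (- sqrt (2 * a) * (z \<bullet> w)) \<partial>gauss)"

text \<open>The expectation of exp (-a |X - w|^2) for a centred planar normal X whose coordinates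
  are independent with variance V / 2.\<close>

definition gauss_main :: "real \<Rightarrow> real \<Rightarrow> complex \<Rightarrow> real" where
  "gauss_main V a w = exp (- a * (norm w)\<^sup>2 / (1 + a * V)) / (1 + a * V)"

lemma measurable_phi_scaled [measurable]: "(\<lambda>z. phi N (b *\<^sub>R z)) \<in> borel_measurable borel"
  by (intro borel_measurable_continuous_onI continuous_on_compose2[OF continuous_phi] continuous_intros) auto

lemma measurable_cis_inner [measurable]: "(\<lambda>z. cis (b * (z \<bullet> w))) \<in> borel_measurable borel" for w :: complex
  by (intro borel_measurable_continuous_onI continuous_intros)

text \<open>The first error term integrates \<open>phi_gauss_approx\<close>. The second comes from
  |b z| > V^3, where the trivial bound 2 is multiplied by exp (|z|^2 / 4 - V^6 / (8a)) \<ge> 1, a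
  Chernoff-type estimate.\<close>

lemma gauss_phi_approx:
  assumes V8: "prime_recip N \<ge> 10 ^ 8" and a: "a > 0"
  shows "norm (gauss_phi N a w - of_real (gauss_main (prime_recip N) a w)) \<le>
    33792 / (a * (prime_recip N)\<^sup>2) + 32 * a / prime_recip N ^ 6"
proof -
  interpret prob_space gauss by (rule prob_space_gauss)
  define V where "V = prime_recip N"
  have V: "V \<ge> 10 ^ 8" using V8 by (simp add: V_def)
  then have Vpos: "V > 0" by simp
  define b where "b = sqrt (2 * a)"
  have b2: "b\<^sup>2 = 2 * a" "b \<ge> 0" using a by (simp_all add: b_def)
  have nb: "(norm (b *\<^sub>R z))\<^sup>2 = 2 * a * (norm z)\<^sup>2" for z :: complex
    using b2 by (simp add: power_mult_distrib)
  \<comment> \<open>The three weights used: the main Gaussian, the error of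
    \<open>phi_gauss_approx\<close> at b z, and the growing weight for the tail.\<close>
  have s1: "a * V / 2 > -1/2" "a * V / 16 > -1/2" "-1/4 > (-1/2 :: real)"
    using mult_pos_pos[OF a Vpos] by simp_all
  let ?c = "\<lambda>z. cis (- b * (z \<bullet> w))"
  let ?G = "\<lambda>z :: complex. complex_of_real (exp (- (a * V / 2) * (norm z)\<^sup>2))"
  define D where "D = (\<lambda>z. phi N (b *\<^sub>R z) - ?G z)"
  define B where "B = (\<lambda>z :: complex. 4224 / V * exp (- (a * V / 16) * (norm z)\<^sup>2) + 2 * exp (- (V ^ 6 / (8 * a))) * exp (- (-1/4) * (norm z)\<^sup>2))"
  have DB: "norm (D z) \<le> B z" for z
  proof (cases "norm (b *\<^sub>R z) \<le> V ^ 3")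
    case True
    have e1: "- (norm (b *\<^sub>R z))\<^sup>2 * V / 4 = - (a * V / 2) * (norm z)\<^sup>2"
      and e2: "- (norm (b *\<^sub>R z))\<^sup>2 * V / 32 = - (a * V / 16) * (norm z)\<^sup>2"
      unfolding nb by simp_all
    have "norm (D z) \<le> 4224 / V * exp (- (a * V / 16) * (norm z)\<^sup>2)"
      using phi_gauss_approx[OF V8, of "b *\<^sub>R z"] True unfolding V_def[symmetric] e1 e2 D_def by simp
    also have "\<dots> \<le> B z" by (simp add: B_def)
    finally show ?thesis .
  next
    case False
    then have "(V ^ 3)\<^sup>2 \<le> (norm (b *\<^sub>R z))\<^sup>2" using Vpos by (intro power_mono) auto
    then have "V ^ 6 \<le> 2 * a * (norm z)\<^sup>2" unfolding nb by (simp flip: power_mult)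
    then have "0 \<le> - (V ^ 6 / (8 * a)) + - (-1/4) * (norm z)\<^sup>2" using a by (simp add: field_simps)
    then have "1 \<le> exp (- (V ^ 6 / (8 * a))) * exp (- (-1/4) * (norm z)\<^sup>2)"
      unfolding exp_add[symmetric] by simp
    moreover have "norm (D z) \<le> 1 + 1"
      unfolding D_def
      by (rule order_trans[OF norm_triangle_ineq4 add_mono[OF norm_phi_le_1]]) (use a Vpos in simp)
    ultimately have "norm (D z) \<le> 2 * (exp (- (V ^ 6 / (8 * a))) * exp (- (-1/4) * (norm z)\<^sup>2))" by linarith
    also have "\<dots> \<le> B z" using Vpos by (simp add: B_def)
    finally show ?thesis .
  qed
  have intB: "integrable gauss B"
    unfolding B_def by (intro Bochner_Integration.integrable_add integrable_mult_right gauss_exp_square(1) s1)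
  have intPhi: "integrable gauss (\<lambda>z. phi N (b *\<^sub>R z) * ?c z)"
  proof (rule integrable_const_bound[where B = 1])
    show "(\<lambda>z. phi N (b *\<^sub>R z) * ?c z) \<in> borel_measurable gauss" by measurable
  qed (auto simp: norm_mult norm_phi_le_1)
  have expo: "- (- b)\<^sup>2 * (norm w)\<^sup>2 / (2 * (1 + 2 * (a * V / 2))) = - a * (norm w)\<^sup>2 / (1 + a * V)"
  proof -
    have "- (- b)\<^sup>2 * (norm w)\<^sup>2 = 2 * (- a * (norm w)\<^sup>2)" using b2 by simp
    moreover have "1 + 2 * (a * V / 2) = 1 + a * V" by simp
    ultimately show ?thesis by (simp only: mult_divide_mult_cancel_left_if) simp
  qed
  have den: "1 + 2 * (a * V / 2) = 1 + a * V" by simp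
  have main: "integrable gauss (\<lambda>z. ?G z * ?c z)" "(\<integral>z. ?G z * ?c z \<partial>gauss) = of_real (gauss_main V a w)"
    using gauss_exp_square_cis[OF s1(1), of "- b" w] unfolding expo unfolding den gauss_main_def by (simp_all only:)
  have "gauss_phi N a w - of_real (gauss_main V a w) = (\<integral>z. phi N (b *\<^sub>R z) * ?c z \<partial>gauss) - (\<integral>z. ?G z * ?c z \<partial>gauss)"
    unfolding main(2) by (simp add: gauss_phi_def b_def)
  also have "\<dots> = (\<integral>z. D z * ?c z \<partial>gauss)"
    using Bochner_Integration.integral_diff[OF intPhi main(1)] by (simp add: D_def left_diff_distrib)
  also have "norm \<dots> \<le> (\<integral>z. B z \<partial>gauss)"
  proof (rule order_trans[OF integral_norm_bound integral_mono_AE])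
    show "integrable gauss (\<lambda>z. norm (D z * ?c z))"
      using Bochner_Integration.integrable_diff[OF intPhi main(1)] by (simp add: D_def left_diff_distrib)
  qed (use intB DB in \<open>auto simp: norm_mult\<close>)
  also have "\<dots> = 4224 / V * (1 / (1 + 2 * (a * V / 16))) + 2 * exp (- (V ^ 6 / (8 * a))) * (1 / (1 + 2 * (-1/4)))"
    unfolding B_def
    by (simp only: Bochner_Integration.integral_add[OF integrable_mult_right[OF gauss_exp_square(1)[OF s1(2)]]
          integrable_mult_right[OF gauss_exp_square(1)[OF s1(3)]]]
        integral_mult_right_zero gauss_exp_square(2)[OF s1(2)] gauss_exp_square(2)[OF s1(3)])
  also have "\<dots> \<le> 4224 / V * (8 / (a * V)) + 2 * (8 * a / V ^ 6) * 2"
  proof (intro add_mono mult_mono)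
    have "1 / (1 + 2 * (a * V / 16)) \<le> 1 / (a * V / 8)" by (intro frac_le) (use mult_pos_pos[OF a Vpos] in simp_all)
    then show "1 / (1 + 2 * (a * V / 16)) \<le> 8 / (a * V)" by simp
    show "exp (- (V ^ 6 / (8 * a))) \<le> 8 * a / V ^ 6"
      using mult_exp_neg_le[of "V ^ 6 / (8 * a)"] a Vpos by (simp add: field_simps)
  qed (use a Vpos in auto)
  also have "\<dots> = 33792 / (a * V\<^sup>2) + 32 * a / V ^ 6" by (simp add: power2_eq_square)
  finally show ?thesis unfolding V_def .
qed

text \<open>In units of 1 / (a V) the first term is at least 0.98 - 0.001, as |w|^2 \<le> V / 100
  keeps the exponential near 1. The second is at most 2.2, and 2.2 / 5 leaves more than 1/2. The
  condition a \<le> V^2 controls the tail error.\<close>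

lemma gauss_phi_lower:
  assumes V: "V = prime_recip N" "V \<ge> 10 ^ 8" and a: "a \<ge> 16" "a \<le> V\<^sup>2" and w: "(norm w)\<^sup>2 \<le> V / 100"
  shows "Re (gauss_phi N a w) - exp (- 2) * Re (gauss_phi N (a / 2) w) \<ge> 1 / (2 * (a * V))"
proof -
  have Vpos: "V > 0" using V by simp
  have apos: "a > 0" using a by simp
  have aV: "a * V > 0" using Vpos apos by simp
  have aV3: "1000 \<le> a * V"
    using mult_mono[of 16 a "10 ^ 8" V] a V by simp
  define y where "y = 1 / (a * V)"
  have y: "y > 0" using aV by (simp add: y_def)
  define E where "E = (\<lambda>a. 33792 / (a * V\<^sup>2) + 32 * a / V ^ 6)"
  have dev: "\<bar>Re (gauss_phi N c w) - gauss_main V c w\<bar> \<le> E c" if "c > 0" for c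
    using gauss_phi_approx[OF V(2)[unfolded V(1)] that, of w] abs_Re_le_cmod[of "gauss_phi N c w - of_real (gauss_main V c w)"]
    unfolding E_def V(1) by simp
  have E1: "E a \<le> 1 / 1000 * y"
  proof -
    have "E a * (a * V) = 33792 / V + 32 * a\<^sup>2 / V ^ 5"
      using Vpos apos by (simp add: E_def field_simps power2_eq_square eval_nat_numeral)
    also have "32 * a\<^sup>2 / V ^ 5 \<le> 32 * (V\<^sup>2)\<^sup>2 / V ^ 5"
      using a Vpos by (intro divide_right_mono mult_left_mono power_mono) auto
    also have "32 * (V\<^sup>2)\<^sup>2 / V ^ 5 = 32 / V" using Vpos by (simp add: field_simps eval_nat_numeral)
    also have "33792 / V + 32 / V \<le> 1 / 1000" using V(2) Vpos by (simp add: field_simps)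
    finally have "E a * (a * V) \<le> 1 / 1000" by simp
    then show ?thesis using aV by (simp add: y_def pos_le_divide_eq)
  qed
  have E2: "E (a / 2) \<le> 2 * E a"
    unfolding E_def using Vpos apos by (simp add: field_simps)
  have M1: "gauss_main V a w \<ge> 98 / 100 * y"
  proof -
    have "a * (norm w)\<^sup>2 / (1 + a * V) \<le> a * (V / 100) / (a * V)"
      using w apos Vpos aV by (intro frac_le mult_left_mono) auto
    also have "\<dots> = 1 / 100" using apos Vpos by simp
    finally have "1 - 1 / 100 \<le> 1 + - a * (norm w)\<^sup>2 / (1 + a * V)" by simp
    also have "\<dots> \<le> exp (- a * (norm w)\<^sup>2 / (1 + a * V))" by (rule exp_ge_add_one_self)
    finally have "(99 / 100) / (1 + a * V) \<le> gauss_main V a w"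
      unfolding gauss_main_def using aV by (intro divide_right_mono) auto
    moreover have "98 / 100 * y \<le> (99 / 100) / (1 + a * V)"
      using aV aV3 by (simp add: y_def divide_le_eq pos_le_divide_eq mult.commute)
    ultimately show ?thesis by linarith
  qed
  have M2: "gauss_main V (a / 2) w \<le> 2 * y"
  proof -
    have "gauss_main V (a / 2) w \<le> 1 / (1 + a / 2 * V)"
      unfolding gauss_main_def using aV apos by (intro divide_right_mono) auto
    also have "\<dots> \<le> 1 / (a * V / 2)" using aV by (intro divide_left_mono) auto
    finally show ?thesis by (simp add: y_def)
  qed
  have e2: "exp (- 2 :: real) \<le> 1 / 5"
  proof -
    have "(5 :: real) \<le> exp 2" using exp_lower_Taylor_quadratic[of 2] by simp
    then show ?thesis by (simp add: exp_minus field_simps)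
  qed
  have "Re (gauss_phi N (a / 2) w) \<le> 11 / 5 * y"
    using dev[OF half_gt_zero[OF apos]] E1 E2 M2 y by linarith
  then have "exp (- 2) * Re (gauss_phi N (a / 2) w) \<le> exp (- 2) * (11 / 5 * y)"
    by (rule mult_left_mono) simp
  also have "\<dots> \<le> 1 / 5 * (11 / 5 * y)"
    using e2 y by (intro mult_right_mono) auto
  finally have "exp (- 2) * Re (gauss_phi N (a / 2) w) \<le> 1 / 5 * (11 / 5 * y)" .
  moreover have "Re (gauss_phi N a w) \<ge> 98 / 100 * y - 1 / 1000 * y"
    using dev[OF apos] E1 M1 by linarith
  moreover have "1 / (2 * (a * V)) = 1 / 2 * y" by (simp add: y_def)
  ultimately show ?thesis using y by linarith
qed

subsection \<open>The logarithm of the Euler product\<close>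

text \<open>Adding the logarithms of the factors gives a branch that is continuous in t; the
  principal logarithm of the product could jump.\<close>

definition log_P :: "nat \<Rightarrow> real \<Rightarrow> complex" where
  "log_P N t = (\<Sum>p\<in>primes_upto N. Lc (of_real (1 / sqrt (real p)) * cis (- t * ln (real p))))"

lemma norm_prime_cis:
  assumes "prime (p :: nat)"
  shows "norm (of_real (1 / sqrt (real p)) * cis x) < 1"
  using prime_inv_sqrt[OF assms] by (simp add: norm_mult norm_divide)

lemma prime_powr_critical:
  assumes "prime (p :: nat)"
  shows "(of_nat p :: complex) powr (- (1 / 2) - \<i> * of_real t) = of_real (1 / sqrt (real p)) * cis (- t * ln (real p))"
proof -
  have p: "p > 0" using assms by (rule prime_gt_0_nat)
  have "complex_of_real (1 / sqrt (real p)) = exp (- (1 / 2) * of_real (ln (real p)))"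
  proof -
    have "1 / sqrt (real p) = exp (- (1 / 2) * ln (real p))"
      using p by (simp add: powr_half_sqrt[symmetric] powr_def exp_minus field_simps)
    then have "complex_of_real (1 / sqrt (real p)) = of_real (exp (- (1 / 2) * ln (real p)))" by (simp only:)
    then show ?thesis by (simp only: exp_of_real[symmetric] of_real_mult of_real_minus of_real_divide of_real_1 of_real_numeral)
  qed
  moreover have "cis (- t * ln (real p)) = exp (- (\<i> * of_real t) * of_real (ln (real p)))"
    by (simp add: cis_conv_exp mult.assoc)
  ultimately show ?thesis
    using p by (simp add: powr_def Ln_of_nat exp_add[symmetric] algebra_simps)
qed

lemma euler_P_eq_exp: "euler_P N t = exp (log_P N t)"
proof -
  have "exp (log_P N t) = (\<Prod>p\<in>primes_upto N. exp (Lc (of_real (1 / sqrt (real p)) * cis (- t * ln (real p)))))"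
    unfolding log_P_def by (rule exp_sum) simp
  also have "\<dots> = euler_P N t"
    unfolding euler_P_def primes_upto_def
    by (intro prod.cong refl) (use exp_Lc[OF norm_prime_cis] prime_powr_critical in auto)
  finally show ?thesis by simp
qed

lemma continuous_log_P: "continuous_on S (log_P N)"
  unfolding log_P_def[abs_def]
  by (intro continuous_intros norm_prime_cis) (auto dest: primes_upto_prime)

text \<open>A character of the sum is a product over primes whose factor at p depends on t only
  through p^(-it).\<close>

lemma has_mean_log_P: "has_mean (\<lambda>t. cis (\<xi> \<bullet> log_P N t)) (phi N \<xi>)"
proof -
  let ?f = "\<lambda>p z. cis (\<xi> \<bullet> Lc (of_real (1 / sqrt (real p)) * z))"
  have "has_mean (\<lambda>t. \<Prod>p\<in>primes_upto N. ?f p (cis (- t * ln (real p)))) (\<Prod>p\<in>primes_upto N. integral {0..1} (\<lambda>x. ?f p (cis (2 * pi * x))))"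
  proof (rule has_mean_prod_primes)
    fix p assume "p \<in> primes_upto N"
    then have "prime p" by (rule primes_upto_prime)
    then show "continuous_on (sphere 0 1) (?f p)"
      using prime_inv_sqrt[of p] by (intro continuous_intros) (auto simp: norm_mult norm_divide)
  qed (auto dest: primes_upto_prime)
  moreover have "(\<Prod>p\<in>primes_upto N. ?f p (cis (- t * ln (real p)))) = cis (\<xi> \<bullet> log_P N t)" for t
    by (simp add: log_P_def inner_sum_right cis_conv_exp exp_sum[symmetric] sum_distrib_left)
  ultimately show ?thesis by (simp add: phi_def psi_def)
qed

lemma set_lborel_integral_continuous:
  fixes f :: "real \<Rightarrow> 'a::euclidean_space"
  assumes "continuous_on {0..T} f"
  shows "(LINT t:{0..T}|lborel. f t) = integral {0..T} f"
  by (rule set_borel_integral_eq_integral(2)[OF borel_integrable_atLeastAtMost'[OF assms]])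

text \<open>Write the Gaussian as an average of characters, exchange it with the time integral by
  Fubini, and let T tend to infinity under the Gaussian integral. Characters have norm 1, so the
  constant 1 dominates.\<close>

lemma time_average_gauss:
  assumes a: "a > 0"
  shows "((\<lambda>T. 1 / T * (LINT t:{0..T}|lborel. exp (- a * (norm (log_P N t - w))\<^sup>2))) \<longlongrightarrow> Re (gauss_phi N a w)) at_top"
proof -
  interpret gauss: prob_space gauss by (rule prob_space_gauss)
  interpret pair_sigma_finite gauss lborel
    by (intro pair_sigma_finite.intro gauss.sigma_finite_measure_axioms sigma_finite_lborel)
  define b where "b = sqrt (2 * a)"
  have b2: "b\<^sup>2 = 2 * a" using a by (simp add: b_def)
  define F where "F = (\<lambda>z t. cis (b * (z \<bullet> (log_P N t - w))))"
  have contF: "continuous_on S (F z)" for z S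
    unfolding F_def by (intro continuous_intros continuous_log_P)
  have [measurable]: "log_P N \<in> borel_measurable borel"
    by (intro borel_measurable_continuous_onI continuous_log_P)
  have [measurable]: "cis \<in> borel_measurable borel"
    by (intro borel_measurable_continuous_onI continuous_intros)
  define S where "S = (\<lambda>T z. (1 / of_real T) * (LINT t:{0..T}|lborel. F z t))"
  have measF [measurable]: "(\<lambda>(z, t). indicator {0..T} t *\<^sub>R F z t) \<in> borel_measurable (gauss \<Otimes>\<^sub>M lborel)" for T
    unfolding F_def by measurable
  have measS: "S T \<in> borel_measurable gauss" for T
    unfolding S_def set_lebesgue_integral_def by measurable
  have intFz: "integrable lborel (\<lambda>t. indicator {0..T} t *\<^sub>R F z t)" for z T
    using borel_integrable_atLeastAtMost'[OF contF] by (simp add: set_integrable_def)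
  have intF: "integrable (gauss \<Otimes>\<^sub>M lborel) (\<lambda>(z, t). indicator {0..T} t *\<^sub>R F z t)" for T
  proof (rule Fubini_integrable)
    have "(\<lambda>z. \<integral>t. norm (case (z, t) of (z, t) \<Rightarrow> indicator {0..T} t *\<^sub>R F z t) \<partial>lborel) = (\<lambda>z. \<integral>t. indicator {0..T} t \<partial>lborel)"
      by (simp add: F_def)
    then show "integrable gauss (\<lambda>z. \<integral>t. norm (case (z, t) of (z, t) \<Rightarrow> indicator {0..T} t *\<^sub>R F z t) \<partial>lborel)"
      by simp
  qed (use intFz in auto)
  have gaussF: "(\<integral>z. F z t \<partial>gauss) = of_real (exp (- a * (norm (log_P N t - w))\<^sup>2))" for t
    using gauss_exp_square_cis(2)[of 0 b "log_P N t - w"] b2 by (simp add: F_def)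
  have swap: "(\<integral>z. S T z \<partial>gauss) = of_real (1 / T * (LINT t:{0..T}|lborel. exp (- a * (norm (log_P N t - w))\<^sup>2)))" for T
  proof -
    have "(\<integral>z. (LINT t:{0..T}|lborel. F z t) \<partial>gauss) = (\<integral>t. (\<integral>z. indicator {0..T} t *\<^sub>R F z t \<partial>gauss) \<partial>lborel)"
      unfolding set_lebesgue_integral_def using integral_fst[OF intF] integral_snd[OF intF] by simp
    also have "\<dots> = (LINT t:{0..T}|lborel. complex_of_real (exp (- a * (norm (log_P N t - w))\<^sup>2)))"
      unfolding set_lebesgue_integral_def by (simp add: gaussF)
    also have "\<dots> = of_real (LINT t:{0..T}|lborel. exp (- a * (norm (log_P N t - w))\<^sup>2))"
      unfolding set_lebesgue_integral_def integral_complex_of_real[symmetric]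
      by (intro Bochner_Integration.integral_cong) (simp_all add: scaleR_conv_of_real)
    finally show ?thesis by (simp add: S_def)
  qed
  have "((\<lambda>T. \<integral>z. S T z \<partial>gauss) \<longlongrightarrow> (\<integral>z. phi N (b *\<^sub>R z) * cis (- b * (z \<bullet> w)) \<partial>gauss)) at_top"
  proof (rule integral_dominated_convergence_at_top[where w = "\<lambda>_. 1"])
    show "AE z in gauss. ((\<lambda>T. S T z) \<longlongrightarrow> phi N (b *\<^sub>R z) * cis (- b * (z \<bullet> w))) at_top"
    proof (rule AE_I2)
      fix z
      have eq: "F z = (\<lambda>t. cis (- b * (z \<bullet> w)) * cis ((b *\<^sub>R z) \<bullet> log_P N t))"
        by (rule ext) (simp add: F_def cis_mult inner_diff_right algebra_simps)
      have "has_mean (F z) (cis (- b * (z \<bullet> w)) * phi N (b *\<^sub>R z))"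
        unfolding eq by (intro has_mean_cmult has_mean_log_P)
      then show "((\<lambda>T. S T z) \<longlongrightarrow> phi N (b *\<^sub>R z) * cis (- b * (z \<bullet> w))) at_top"
        by (simp add: has_mean_def S_def set_lborel_integral_continuous[OF contF] mult.commute)
    qed
    show "eventually (\<lambda>T. AE z in gauss. norm (S T z) \<le> 1) at_top"
      using eventually_gt_at_top[of "0::real"]
    proof eventually_elim
      case (elim T)
      have "norm (integral {0..T} (F z)) \<le> 1 * (T - 0)" for z
        by (rule integral_bound) (use elim contF in \<open>auto simp: F_def\<close>)
      then show ?case
        using elim by (auto simp: S_def set_lborel_integral_continuous[OF contF] norm_mult norm_divide divide_le_eq)
    qed
    show "(\<lambda>z. phi N (b *\<^sub>R z) * cis (- b * (z \<bullet> w))) \<in> borel_measurable gauss" by measurable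
  qed (use measS in auto)
  then have "((\<lambda>T. Re (\<integral>z. S T z \<partial>gauss)) \<longlongrightarrow> Re (gauss_phi N a w)) at_top"
    unfolding gauss_phi_def b_def by (rule tendsto_Re)
  then show ?thesis unfolding swap Re_complex_of_real .
qed

text \<open>Inside the disc the first Gaussian is at most 1. Outside, a |x|^2 / 2 \<ge> 2, so the
  second term outweighs the first.\<close>

lemma gauss_minorant:
  fixes x :: complex
  assumes r: "r > 0" and a: "a = 4 / r\<^sup>2"
  shows "exp (- a * (norm x)\<^sup>2) - exp (- 2) * exp (- (a / 2) * (norm x)\<^sup>2) \<le> (if norm x < r then 1 else 0)"
proof (cases "norm x < r")
  case True
  have "a > 0" using r a by simp
  then have "exp (- a * (norm x)\<^sup>2) \<le> 1" by simp
  moreover have "exp (- 2) * exp (- (a / 2) * (norm x)\<^sup>2) \<ge> 0" by simp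
  ultimately show ?thesis unfolding if_P[OF True] by linarith
next
  case False
  then have "r\<^sup>2 \<le> (norm x)\<^sup>2" using r by (intro power_mono) auto
  then have "a / 2 * r\<^sup>2 \<le> a / 2 * (norm x)\<^sup>2" using r a by (intro mult_left_mono) auto
  moreover have "a / 2 * r\<^sup>2 = 2" using r a by simp
  ultimately have "- a * (norm x)\<^sup>2 \<le> - 2 + - (a / 2) * (norm x)\<^sup>2" by simp
  then have "exp (- a * (norm x)\<^sup>2) \<le> exp (- 2) * exp (- (a / 2) * (norm x)\<^sup>2)"
    unfolding exp_add[symmetric] by simp
  then show ?thesis using False by simp
qed

text \<open>With |x| < r \<le> 1/2 and |e^x - 1| \<le> 3/2 |x|, the relative error of the product is
  below 3/4 of e / |z|. The branch of \<open>log_P\<close> is immaterial after exponentiation. The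
  value of \<open>a\<close> is 4 / r^2 for r = e / (2 |z|).\<close>

lemma measure_euler_P_ge:
  assumes z: "z \<noteq> 0" and e: "e > 0" "e \<le> norm z" and a: "a = 16 * (norm z / e)\<^sup>2" and T: "T > 0"
  shows "(LINT t:{0..T}|lborel. exp (- a * (norm (log_P N t - Ln z))\<^sup>2))
      - exp (- 2) * (LINT t:{0..T}|lborel. exp (- (a / 2) * (norm (log_P N t - Ln z))\<^sup>2))
    \<le> measure lebesgue {t \<in> {0..T}. norm (euler_P N t - z) < e}"
proof -
  let ?S = "{t \<in> {0..T}. norm (euler_P N t - z) < e}"
  let ?g = "\<lambda>a t. exp (- a * (norm (log_P N t - Ln z))\<^sup>2)"
  define r where "r = e / (2 * norm z)"
  have r: "r > 0" "r \<le> 1 / 2" "a = 4 / r\<^sup>2"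
    using z e a by (auto simp: r_def power_divide field_simps)
  have contg: "continuous_on {0..T} (?g a)" for a by (intro continuous_intros continuous_log_P)
  have intg: "set_integrable lborel {0..T} (?g a)" for a
    by (rule borel_integrable_atLeastAtMost'[OF contg])
  have meas: "?S \<in> sets borel"
  proof -
    have "open {t. norm (exp (log_P N t) - z) < e}"
      by (intro open_Collect_less continuous_intros continuous_log_P)
    then have "{0..T} \<inter> {t. norm (exp (log_P N t) - z) < e} \<in> sets borel" by (intro sets.Int borel_closed borel_open) auto
    also have "{0..T} \<inter> {t. norm (exp (log_P N t) - z) < e} = ?S" by (auto simp: euler_P_eq_exp)
    finally show ?thesis .
  qed
  have close: "t \<in> ?S" if "norm (log_P N t - Ln z) < r" "t \<in> {0..T}" for t
  proof -
    have "euler_P N t - z = z * (exp (log_P N t - Ln z) - 1)"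
      using z by (simp add: euler_P_eq_exp exp_diff field_simps)
    then have "norm (euler_P N t - z) = norm z * norm (exp (log_P N t - Ln z) - 1)" by (simp add: norm_mult)
    also have "\<dots> \<le> norm z * (3 / 2 * norm (log_P N t - Ln z))"
      using that r by (intro mult_left_mono norm_exp_bounds(2)) auto
    also have "\<dots> < norm z * (3 / 2 * r)" using that z by simp
    also have "\<dots> = 3 / 4 * e" using z by (simp add: r_def)
    also have "\<dots> < e" using e by simp
    finally show ?thesis using that by simp
  qed
  have intS: "set_integrable lborel {0..T} (indicator ?S :: real \<Rightarrow> real)"
  proof -
    have "emeasure lborel ?S \<le> emeasure lborel {0..T}" by (intro emeasure_mono) auto
    also have "\<dots> < \<infinity>" using T by (simp add: ennreal_less_top)
    finally have "integrable lborel (indicator ?S :: real \<Rightarrow> real)" using meas by simp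
    moreover have "(\<lambda>t. indicator {0..T} t *\<^sub>R indicator ?S t) = (indicator ?S :: real \<Rightarrow> real)"
      by (auto simp: indicator_def)
    ultimately show ?thesis by (simp add: set_integrable_def)
  qed
  have "(LINT t:{0..T}|lborel. ?g a t) - exp (- 2) * (LINT t:{0..T}|lborel. ?g (a / 2) t)
     = (LINT t:{0..T}|lborel. ?g a t - exp (- 2) * ?g (a / 2) t)"
    using set_integral_diff(2)[OF intg[of a] set_integrable_mult_right[of "exp (- 2)", OF intg[of "a / 2"]]]
    by (simp only: set_integral_mult_right)
  also have "\<dots> \<le> (LINT t:{0..T}|lborel. indicator ?S t)"
  proof (rule set_integral_mono)
    show "set_integrable lborel {0..T} (\<lambda>t. ?g a t - exp (- 2) * ?g (a / 2) t)"
      using set_integral_diff(1)[OF intg set_integrable_mult_right[OF intg]] .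
    fix t assume t: "t \<in> {0..T}"
    show "?g a t - exp (- 2) * ?g (a / 2) t \<le> indicator ?S t"
      using gauss_minorant[OF r(1,3), of "log_P N t - Ln z"] close[OF _ t]
      by (cases "norm (log_P N t - Ln z) < r") (auto intro: order_trans[OF _ indicator_pos_le])
  qed (rule intS)
  also have "\<dots> = (\<integral>t. indicator ?S t \<partial>lborel)"
    unfolding set_lebesgue_integral_def by (rule Bochner_Integration.integral_cong) (auto simp: indicator_def)
  also have "\<dots> = measure lborel ?S" using meas by simp
  also have "\<dots> = measure lebesgue ?S" using meas by simp
  finally show ?thesis .
qed

subsection \<open>The lower bound\<close>

text \<open>The threshold gives ln N \<ge> 11, so 1 + ln N \<le> (ln N)^2. The constant 12 is 2 * 3
  * 2, using exp 1 \<le> 3.\<close>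

lemma prime_recip_bounds:
  assumes N: "real N \<ge> exp (exp 10)"
  shows "prime_recip N \<ge> ln (ln (real N)) - 1" "prime_recip N \<le> 12 * ln (ln (real N))"
proof -
  have e10: "exp 10 \<ge> (11 :: real)" using exp_ge_add_one_self[of 10] by simp
  have "exp (exp 10) \<ge> (12 :: real)" using exp_ge_add_one_self[of "exp 10 :: real"] e10 by linarith
  then have N3: "real N \<ge> 12" using N by linarith
  have "exp 10 = ln (exp (exp 10 :: real))" by simp
  also have "\<dots> \<le> ln (real N)" using N by (intro ln_mono) auto
  finally have l: "ln (real N) \<ge> 11" using e10 by linarith
  have "ln 2 \<le> (1 :: real)" using ln_le_minus_one[of "2::real"] by simp
  then show "prime_recip N \<ge> ln (ln (real N)) - 1" using prime_recip_ge[of N] N3 by simp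
  have "1 + ln (real N) \<le> ln (real N) ^ 2" 
  proof -
    have "11 * ln (real N) \<le> ln (real N) * ln (real N)" using l by (intro mult_right_mono) auto
    then show ?thesis using l unfolding power2_eq_square by linarith
  qed
  then have "ln (1 + ln (real N)) \<le> ln (ln (real N) ^ 2)" using l by (intro ln_mono) auto
  also have "\<dots> = 2 * ln (ln (real N))" using l by (simp add: ln_realpow)
  finally have "ln (1 + ln (real N)) \<le> 2 * ln (ln (real N))" .
  then have "2 * exp 1 * ln (1 + ln (real N)) \<le> (2 * 3) * (2 * ln (ln (real N)))"
    using exp_le l by (intro mult_mono) auto
  then show "prime_recip N \<le> 12 * ln (ln (real N))" using prime_recip_le[of N] N3 by simp
qed

lemma norm_Ln_square_le:
  assumes "z \<noteq> 0"
  shows "(norm (Ln z))\<^sup>2 \<le> (ln (norm z))\<^sup>2 + 16"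
proof -
  have "\<bar>Im (Ln z)\<bar> \<le> pi" using mpi_less_Im_Ln[OF assms] Im_Ln_le_pi[OF assms] by simp
  then have "\<bar>Im (Ln z)\<bar>\<^sup>2 \<le> 4\<^sup>2" using pi_less_4 by (intro power_mono) auto
  then show ?thesis using assms by (simp add: cmod_power2 Re_Ln)
qed

theorem theorem2:
  shows "\<exists>c::real. c > 0 \<and>
    (\<forall>(z\<^sub>0::complex) (\<epsilon>::real). z\<^sub>0 \<noteq> 0 \<and> 0 < \<epsilon> \<and> \<epsilon> \<le> norm z\<^sub>0 \<longrightarrow>
      (\<exists>N\<^sub>0::real.
        N\<^sub>0 \<le> exp (exp (10 ^ 20 * (1 + (ln (norm z\<^sub>0))\<^sup>2 + norm z\<^sub>0 / \<epsilon>))) \<and>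
        (\<forall>N::nat. real N \<ge> N\<^sub>0 \<longrightarrow>
          Liminf at_top (\<lambda>T::real.
              ereal (1 / T * measure lebesgue {t \<in> {0..T}. norm (euler_P N t - z\<^sub>0) < \<epsilon>}))
            \<ge> ereal (c * ((\<epsilon> / norm z\<^sub>0)\<^sup>2 * (1 / ln (ln (real N))))))))"
proof (rule exI[of _ "1 / 384"], intro conjI allI impI)
  fix z :: complex and e :: real
  assume "z \<noteq> 0 \<and> 0 < e \<and> e \<le> norm z"
  then have z: "z \<noteq> 0" "0 < e" "e \<le> norm z" by auto
  \<comment> \<open>(ln |z|)^2 in \<open>K\<close> yields |w|^2 \<le> V / 100, and |z| / e yields a
    \<le> V^2. The factor 10^20 leaves V \<ge> 10^19 K, which also covers V \<ge> 10^8.\<close>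
  define K where "K = 1 + (ln (norm z))\<^sup>2 + norm z / e"
  define q where "q = norm z / e"
  have q: "q \<ge> 1" using z by (simp add: q_def)
  have K: "K \<ge> 1" "K \<ge> q" "K \<ge> 1 + (ln (norm z))\<^sup>2"
    using q by (auto simp: K_def q_def)
  show "\<exists>N\<^sub>0::real. N\<^sub>0 \<le> exp (exp (10 ^ 20 * (1 + (ln (norm z))\<^sup>2 + norm z / e))) \<and>
        (\<forall>N::nat. real N \<ge> N\<^sub>0 \<longrightarrow>
          Liminf at_top (\<lambda>T::real.
              ereal (1 / T * measure lebesgue {t \<in> {0..T}. norm (euler_P N t - z) < e}))
            \<ge> ereal (1 / 384 * ((e / norm z)\<^sup>2 * (1 / ln (ln (real N))))))"
  proof (intro exI[of _ "exp (exp (10 ^ 20 * K))"] conjI allI impI)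
    fix N :: nat assume N: "real N \<ge> exp (exp (10 ^ 20 * K))"
    define V where "V = prime_recip N"
    define L where "L = ln (ln (real N))"
    define a where "a = 16 * q\<^sup>2"
    let ?w = "Ln z"
    have "exp (exp 10) \<le> exp (exp (10 ^ 20 * K))" using K(1) by simp
    then have "real N \<ge> exp (exp 10)" using N by linarith
    from prime_recip_bounds[OF this] have V: "V \<ge> L - 1" "V \<le> 12 * L" by (auto simp: V_def L_def)
    have L: "L \<ge> 10 ^ 20 * K"
    proof -
      have "exp (10 ^ 20 * K) = ln (exp (exp (10 ^ 20 * K)))" by simp
      also have "\<dots> \<le> ln (real N)" using N by (intro ln_mono) auto
      finally have "ln (exp (10 ^ 20 * K)) \<le> ln (ln (real N))" by (intro ln_mono) auto
      then show ?thesis by (simp add: L_def)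
    qed
    have VK: "V \<ge> 10 ^ 19 * K" using V(1) L K(1) by simp
    have V8: "V \<ge> 10 ^ 8" using VK K(1) by simp
    have Vpos: "V > 0" using V8 by simp
    have a16: "a \<ge> 16" using q by (simp add: a_def)
    have aV2: "a \<le> V\<^sup>2"
    proof -
      have "4 * q \<le> V" using VK K(1,2) by simp
      then have "(4 * q)\<^sup>2 \<le> V\<^sup>2" using q by (intro power_mono) auto
      then show ?thesis by (simp add: a_def power_mult_distrib)
    qed
    have w: "(norm ?w)\<^sup>2 \<le> V / 100"
      using norm_Ln_square_le[OF z(1)] VK K(1,3) by simp
    let ?I = "\<lambda>a T. LINT t:{0..T}|lborel. exp (- a * (norm (log_P N t - ?w))\<^sup>2)"
    define R where "R = Re (gauss_phi N a ?w) - exp (- 2) * Re (gauss_phi N (a / 2) ?w)"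
    have "((\<lambda>T. 1 / T * ?I a T - exp (- 2) * (1 / T * ?I (a / 2) T)) \<longlongrightarrow> R) at_top"
      unfolding R_def using a16 by (intro tendsto_intros time_average_gauss) auto
    then have lim: "((\<lambda>T. ereal (1 / T * ?I a T - exp (- 2) * (1 / T * ?I (a / 2) T))) \<longlongrightarrow> ereal R) at_top"
      by simp
    have "eventually (\<lambda>T. ereal (1 / T * ?I a T - exp (- 2) * (1 / T * ?I (a / 2) T)) \<le>
      ereal (1 / T * measure lebesgue {t \<in> {0..T}. norm (euler_P N t - z) < e})) at_top"
      using eventually_gt_at_top[of "0::real"]
    proof eventually_elim
      case (elim T)
      have "1 / T * (?I a T - exp (- 2) * ?I (a / 2) T) \<le> 1 / T * measure lebesgue {t \<in> {0..T}. norm (euler_P N t - z) < e}"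
        using elim by (intro mult_left_mono measure_euler_P_ge[OF z]) (auto simp: a_def q_def)
      moreover have "1 / T * (?I a T - exp (- 2) * ?I (a / 2) T) = 1 / T * ?I a T - exp (- 2) * (1 / T * ?I (a / 2) T)"
        by (simp add: right_diff_distrib)
      ultimately show ?case by simp
    qed
    from Liminf_mono[OF this] have "ereal R \<le> Liminf at_top (\<lambda>T. ereal (1 / T * measure lebesgue {t \<in> {0..T}. norm (euler_P N t - z) < e}))"
      by (simp only: lim_imp_Liminf[OF trivial_limit_at_top_linorder lim])
    moreover have "ereal (1 / 384 * ((e / norm z)\<^sup>2 * (1 / L))) \<le> ereal R"
    proof -
      have "1 / (2 * (a * V)) \<le> R"
        unfolding R_def by (rule gauss_phi_lower[OF V_def V8 a16 aV2 w])
      \<comment> \<open>Here 1/V becomes 1 / log log N; with a = 16 q^2 the constant is 384 = 2 * 16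
        * 12.\<close>
      moreover have "1 / (2 * (a * (12 * L))) \<le> 1 / (2 * (a * V))"
        using V(2) Vpos a16 by (intro divide_left_mono mult_left_mono) auto
      moreover have "1 / (2 * (a * (12 * L))) = 1 / 384 * ((e / norm z)\<^sup>2 * (1 / L))"
        using z by (simp add: a_def q_def power_divide)
      ultimately have "1 / 384 * ((e / norm z)\<^sup>2 * (1 / L)) \<le> R" by linarith
      then show ?thesis by (simp only: ereal_less_eq(3))
    qed
    ultimately show "Liminf at_top (\<lambda>T. ereal (1 / T * measure lebesgue {t \<in> {0..T}. norm (euler_P N t - z) < e}))
       \<ge> ereal (1 / 384 * ((e / norm z)\<^sup>2 * (1 / ln (ln (real N)))))"
      unfolding L_def[symmetric] by (rule order_trans[rotated])
  qed (simp add: K_def)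
qed simp

end
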